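(* Let $\Gamma\subset \mathsf{Homeo}(M)$ be a non-elementary convergence group and let $\sigma$ be an expanding $\kappa$-coarse-cocycle for $\Gamma$ with $\delta:=\delta_\sigma(\Gamma) < + \infty$. Then there exists a $2\kappa\delta$-coarse $\sigma$-Patterson--Sullivan measure of dimension $\delta$, which is supported on the limit set $\Lambda(\Gamma)$.
   Context: Convergence groups. $M$ is a compact metrizable space. A subgroup $\Gamma\subset\mathsf{Homeo}(M)$ is a (discrete) convergence group if for every sequence $\{\gamma_n\}$ of distinct elements of $\Gamma$ there are $x,y\in M$ and a subsequence $\{\gamma_{n_j}\}$ such that $\gamma_{n_j}|_{M\smallsetminus\{y\}}$ converges locally uniformly to the constant $x$. The limit set $\Lambda(\Gamma)$ is the set of $x\in M$ for which there are $y\in M$ and a sequence $\{\gamma_n\}\subset\Gamma$ with $\gamma_n|_{M\smallsetminus\{y\}}\to x$ locally uniformly. $\Gamma$ is non-elementary if $\#\Lambda(\Gamma)\ge 3$. An element $\gamma$ is loxodromic if it has two fixed points $\gamma^+\ne\gamma^-$ in $\Lambda(\Gamma)$ such that $\gamma^{\pm n}|_{M\smallsetminus\{\gamma^{\mp}\}}$ converges locally uniformly to $\gamma^{\pm}$ as $n\to+\infty$. Compatible metrics. $\Gamma\sqcup M$ carries a unique compact metrizable topology for which the inclusions of $\Gamma$ (discrete) and of $M$ are embeddings and the natural action of $\Gamma$ (left multiplication on $\Gamma$) is a convergence group action. A compatible metric $\mathrm{d}$ is a metric on $\Gamma\sqcup M$ inducing this topology; fix one. Coarse-cocycles. For $\kappa\ge0$,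 $\sigma\colon\Gamma\times M\to\mathbb{R}$ is a $\kappa$-coarse-cocycle if (i) $\limsup_{x\to x_0}|\sigma(\gamma,x_0)-\sigma(\gamma,x)|\le\kappa$ for all $\gamma\in\Gamma$, $x_0\in M$, and (ii) $|\sigma(\gamma_1\gamma_2,x)-(\sigma(\gamma_1,\gamma_2x)+\sigma(\gamma_2,x))|\le\kappa$ for all $\gamma_1,\gamma_2\in\Gamma$, $x\in M$. It is proper if $\sigma(\gamma_n,\gamma_n^+)\to+\infty$ whenever $\{\gamma_n\}\subset\Gamma$ is a sequence of distinct loxodromic elements with $\liminf_n\mathrm{d}(\gamma_n^-,\gamma_n^+)>0$. It is expanding if it is proper and for each $\gamma\in\Gamma$ there is a number $\|\gamma\|_\sigma\in\mathbb{R}$ (the $\sigma$-magnitude) such that for every $\epsilon>0$ there is $C>0$ with $\|\gamma\|_\sigma-C\le\sigma(\gamma,x)\le\|\gamma\|_\sigma+C$ whenever $x\in M$, $\gamma\in\Gamma$ and $\mathrm{d}(x,\gamma^{-1})>\epsilon$ (here $\gamma^{-1}$ is a point of $\Gamma\sqcup M$). The magnitude function is any fixed choice; two choices differ by a bounded amount. Critical exponent: $\delta_\sigma(\Gamma)=\inf\{s>0:\sum_{\gamma\in\Gamma}e^{-s\|\gamma\|_\sigma}<+\infty\}\in[0,+\infty]$. Patterson--Sullivan measures: a Borel probability measure $\mu$ on $M$ is a $C$-coarse $\sigma$-Patterson--Sullivan measure of dimension $\delta$ if for every $\gamma\in\Gamma$ the measures $\mu$ and $\gamma_*\mu$ are mutually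 absolutely continuous and $e^{-C-\delta\sigma(\gamma^{-1},\cdot)}\le\frac{d\gamma_*\mu}{d\mu}\le e^{C-\delta\sigma(\gamma^{-1},\cdot)}$ $\mu$-almost everywhere. *)

theory Defs
  imports "HOL-Analysis.Analysis" "HOL-Probability.Probability" "HOL-Algebra.Group"
begin

definition homeo_group :: "('m::topological_space \<Rightarrow> 'm) monoid" where
  "homeo_group = \<lparr>carrier = {f. homeomorphic_map euclidean euclidean f}, mult = (\<circ>), one = id\<rparr>"

text \<open>Local uniform convergence on \<open>A\<close> of maps \<open>f n\<close> to the constant \<open>x\<close>: every point of \<open>A\<close> has a
  neighbourhood in \<open>A\<close> on which the convergence is uniform. Since the limit is constant, uniform
  convergence on a set means that every neighbourhood of \<open>x\<close> eventually contains the image of that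
  set, so no metric is involved.\<close>

definition loc_unif_to_const ::
    "'x topology \<Rightarrow> 'x set \<Rightarrow> (nat \<Rightarrow> 'x \<Rightarrow> 'x) \<Rightarrow> 'x \<Rightarrow> bool" where
  "loc_unif_to_const X A f x \<longleftrightarrow>
     (\<forall>p\<in>A. \<exists>W. openin X W \<and> p \<in> W \<and>
        (\<forall>U. openin X U \<and> x \<in> U \<longrightarrow> (\<forall>\<^sub>F n in sequentially. f n ` (W \<inter> A) \<subseteq> U)))"

definition convergence_action :: "'x topology \<Rightarrow> 'g set \<Rightarrow> ('g \<Rightarrow> 'x \<Rightarrow> 'x) \<Rightarrow> bool" where
  "convergence_action X G \<phi> \<longleftrightarrow>
     (\<forall>g\<in>G. homeomorphic_map X X (\<phi> g)) \<and>
     (\<forall>g::nat \<Rightarrow> 'g. inj g \<and> range g \<subseteq> G \<longrightarrow>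
        (\<exists>x\<in>topspace X. \<exists>y\<in>topspace X. \<exists>r::nat \<Rightarrow> nat. strict_mono r \<and>
           loc_unif_to_const X (topspace X - {y}) (\<lambda>j. \<phi> (g (r j))) x))"

definition convergence_group :: "('m::topological_space \<Rightarrow> 'm) set \<Rightarrow> bool" where
  "convergence_group \<Gamma> \<longleftrightarrow>
     subgroup \<Gamma> homeo_group \<and> convergence_action euclidean \<Gamma> (\<lambda>\<gamma>. \<gamma>)"

definition limit_set :: "('m::topological_space \<Rightarrow> 'm) set \<Rightarrow> 'm set" where
  "limit_set \<Gamma> = {x. \<exists>y. \<exists>g::nat \<Rightarrow> 'm \<Rightarrow> 'm. range g \<subseteq> \<Gamma> \<and>
     loc_unif_to_const euclidean (UNIV - {y}) g x}"

definition non_elementary :: "('m::topological_space \<Rightarrow> 'm) set \<Rightarrow> bool" where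
  "non_elementary \<Gamma> \<longleftrightarrow> infinite (limit_set \<Gamma>) \<or> card (limit_set \<Gamma>) \<ge> 3"

text \<open>\<open>loxodromic \<Gamma> \<gamma> p q\<close>: the element \<open>\<gamma>\<close> is loxodromic with \<open>\<gamma>\<^sup>+ = p\<close> and \<open>\<gamma>\<^sup>- = q\<close>.\<close>

definition loxodromic ::
    "('m::topological_space \<Rightarrow> 'm) set \<Rightarrow> ('m \<Rightarrow> 'm) \<Rightarrow> 'm \<Rightarrow> 'm \<Rightarrow> bool" where
  "loxodromic \<Gamma> \<gamma> p q \<longleftrightarrow>
     \<gamma> \<in> \<Gamma> \<and> p \<noteq> q \<and> p \<in> limit_set \<Gamma> \<and> q \<in> limit_set \<Gamma> \<and> \<gamma> p = p \<and> \<gamma> q = q \<and>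
     loc_unif_to_const euclidean (UNIV - {q}) (\<lambda>n. \<gamma> ^^ n) p \<and>
     loc_unif_to_const euclidean (UNIV - {p}) (\<lambda>n. (inv\<^bsub>homeo_group\<^esub> \<gamma>) ^^ n) q"

text \<open>The disjoint union of \<open>\<Gamma>\<close> and the space is \<open>\<Gamma> <+> UNIV\<close>. For a convergence group on a compact
  metrizable space exactly one topology satisfies \<open>compactification\<close>.\<close>

definition compactification ::
    "('m::topological_space \<Rightarrow> 'm) set \<Rightarrow> (('m \<Rightarrow> 'm) + 'm) topology \<Rightarrow> bool" where
  "compactification \<Gamma> X \<longleftrightarrow>
     topspace X = \<Gamma> <+> UNIV \<and> compact_space X \<and> metrizable_space X \<and>
     embedding_map (discrete_topology \<Gamma>) X Inl \<and> embedding_map euclidean X Inr \<and>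
     convergence_action X \<Gamma> (\<lambda>\<gamma>. map_sum (\<lambda>\<eta>. \<gamma> \<circ> \<eta>) \<gamma>)"

definition compatible_metric ::
    "('m::topological_space \<Rightarrow> 'm) set \<Rightarrow> (('m \<Rightarrow> 'm) + 'm \<Rightarrow> ('m \<Rightarrow> 'm) + 'm \<Rightarrow> real) \<Rightarrow> bool" where
  "compatible_metric \<Gamma> d \<longleftrightarrow>
     Metric_space (\<Gamma> <+> UNIV) d \<and>
     compactification \<Gamma> (Metric_space.mtopology (\<Gamma> <+> UNIV) d)"

definition coarse_cocycle ::
    "real \<Rightarrow> ('m::topological_space \<Rightarrow> 'm) set \<Rightarrow> (('m \<Rightarrow> 'm) \<Rightarrow> 'm \<Rightarrow> real) \<Rightarrow> bool" where
  "coarse_cocycle \<kappa> \<Gamma> \<sigma> \<longleftrightarrow>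
     \<kappa> \<ge> 0 \<and>
     (\<forall>\<gamma>\<in>\<Gamma>. \<forall>x0. Limsup (at x0) (\<lambda>x. ereal \<bar>\<sigma> \<gamma> x0 - \<sigma> \<gamma> x\<bar>) \<le> ereal \<kappa>) \<and>
     (\<forall>\<gamma>1\<in>\<Gamma>. \<forall>\<gamma>2\<in>\<Gamma>. \<forall>x. \<bar>\<sigma> (\<gamma>1 \<circ> \<gamma>2) x - (\<sigma> \<gamma>1 (\<gamma>2 x) + \<sigma> \<gamma>2 x)\<bar> \<le> \<kappa>)"

definition proper_cocycle ::
    "('m::topological_space \<Rightarrow> 'm) set \<Rightarrow> (('m \<Rightarrow> 'm) + 'm \<Rightarrow> ('m \<Rightarrow> 'm) + 'm \<Rightarrow> real) \<Rightarrow>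
     (('m \<Rightarrow> 'm) \<Rightarrow> 'm \<Rightarrow> real) \<Rightarrow> bool" where
  "proper_cocycle \<Gamma> d \<sigma> \<longleftrightarrow>
     (\<forall>(g::nat \<Rightarrow> 'm \<Rightarrow> 'm) p q.
        inj g \<and> (\<forall>n. loxodromic \<Gamma> (g n) (p n) (q n)) \<and>
        liminf (\<lambda>n. ereal (d (Inr (q n)) (Inr (p n)))) > 0
        \<longrightarrow> filterlim (\<lambda>n. \<sigma> (g n) (p n)) at_top sequentially)"

definition magnitude ::
    "('m::topological_space \<Rightarrow> 'm) set \<Rightarrow> (('m \<Rightarrow> 'm) + 'm \<Rightarrow> ('m \<Rightarrow> 'm) + 'm \<Rightarrow> real) \<Rightarrow>
     (('m \<Rightarrow> 'm) \<Rightarrow> 'm \<Rightarrow> real) \<Rightarrow> (('m \<Rightarrow> 'm) \<Rightarrow> real) \<Rightarrow> bool" where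
  "magnitude \<Gamma> d \<sigma> mag \<longleftrightarrow>
     (\<forall>\<epsilon>>0. \<exists>C>0. \<forall>x. \<forall>\<gamma>\<in>\<Gamma>. d (Inr x) (Inl (inv\<^bsub>homeo_group\<^esub> \<gamma>)) > \<epsilon> \<longrightarrow>
        mag \<gamma> - C \<le> \<sigma> \<gamma> x \<and> \<sigma> \<gamma> x \<le> mag \<gamma> + C)"

definition expanding ::
    "('m::topological_space \<Rightarrow> 'm) set \<Rightarrow> (('m \<Rightarrow> 'm) + 'm \<Rightarrow> ('m \<Rightarrow> 'm) + 'm \<Rightarrow> real) \<Rightarrow>
     (('m \<Rightarrow> 'm) \<Rightarrow> 'm \<Rightarrow> real) \<Rightarrow> bool" where
  "expanding \<Gamma> d \<sigma> \<longleftrightarrow> proper_cocycle \<Gamma> d \<sigma> \<and> (\<exists>mag. magnitude \<Gamma> d \<sigma> mag)"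

definition critical_exponent :: "'g set \<Rightarrow> ('g \<Rightarrow> real) \<Rightarrow> ereal" where
  "critical_exponent \<Gamma> mag =
     Inf {ereal s |s. s > 0 \<and> (\<lambda>\<gamma>. exp (- s * mag \<gamma>)) summable_on \<Gamma>}"

definition patterson_sullivan ::
    "('m::topological_space \<Rightarrow> 'm) set \<Rightarrow> (('m \<Rightarrow> 'm) \<Rightarrow> 'm \<Rightarrow> real) \<Rightarrow> real \<Rightarrow> real \<Rightarrow>
     'm measure \<Rightarrow> bool" where
  "patterson_sullivan \<Gamma> \<sigma> C \<delta> \<mu> \<longleftrightarrow>
     prob_space \<mu> \<and> sets \<mu> = sets borel \<and>
     (\<forall>\<gamma>\<in>\<Gamma>.
        absolutely_continuous \<mu> (distr \<mu> borel \<gamma>) \<and>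
        absolutely_continuous (distr \<mu> borel \<gamma>) \<mu> \<and>
        (AE x in \<mu>.
           ennreal (exp (- C - \<delta> * \<sigma> (inv\<^bsub>homeo_group\<^esub> \<gamma>) x)) \<le> RN_deriv \<mu> (distr \<mu> borel \<gamma>) x \<and>
           RN_deriv \<mu> (distr \<mu> borel \<gamma>) x \<le> ennreal (exp (C - \<delta> * \<sigma> (inv\<^bsub>homeo_group\<^esub> \<gamma>) x))))"

end

theory Submission imports Defs begin

text \<open>The value of \<open>\<sigma>\<close> is only known on \<open>M\<close>, so the approximating measures are supported on orbits of
  points of \<open>M\<close> rather than on \<open>\<Gamma>\<close>: for a finite set \<open>P\<close> of base points, \<open>g p\<close> carries the mass
  \<open>W(g, p) exp(- \<delta> \<sigma>(g, p)) b\<^sub>n(\<parallel>g\<parallel>)\<close>. The cutoff \<open>W(g, p) = max 0 (d(p, g\<^sup>-\<^sup>1) - \<epsilon>)\<close> vanishes unless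
  \<open>\<sigma>(g, p)\<close> is comparable with \<open>\<parallel>g\<parallel>\<close>; as \<open>P\<close> has three points, some \<open>p\<close> is far from \<open>g\<^sup>-\<^sup>1\<close>; and
  \<open>W(\<alpha> g, p) - W(g, p)\<close> tends to \<open>0\<close> as \<open>g\<close> leaves finite sets, since \<open>g\<^sup>-\<^sup>1\<close> and \<open>g\<^sup>-\<^sup>1\<alpha>\<close> become close.
  The slowly varying weights \<open>b\<^sub>n\<close> make the total mass finite but divergent as \<open>n \<rightarrow> \<infinity>\<close>, so that only
  \<open>g \<rightarrow> \<infinity>\<close> matters.

  The normalised masses of all subsets of \<open>M\<close> converge simultaneously along a filter, by Tychonoff's
  theorem, to a finitely additive set function, from which Caratheodory's construction on compact
  sets gives a Borel measure. The cocycle identity costs a factor \<open>exp(\<kappa> \<delta>)\<close> in the comparison of \<open>\<mu>\<close> with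
  the image measure
  \<open>\<gamma>\<^sub>*\<mu>\<close> on open sets where \<open>\<sigma>(\<gamma>\<^sup>-\<^sup>1, \<cdot>)\<close> is bounded by a constant; localising to small open sets costs
  another one, because \<open>\<sigma>(\<gamma>\<^sup>-\<^sup>1, \<cdot>)\<close> is continuous only up to \<open>\<kappa>\<close>.\<close>

section \<open>Borel measures from contents on compact sets\<close>

text \<open>Induction on \<open>n\<close>: the points of \<open>K\<close> outside the first
  \<open>n\<close> open sets and those outside the last one form disjoint closed sets, so normality
  separates them by disjoint open \<open>S\<close> and \<open>T\<close>. Then \<open>K - S\<close>
  and \<open>K - T\<close> still cover \<open>K\<close>.\<close>

lemma open_cover_closed_pieces:
  fixes K :: "'a::metric_space set" and U :: "nat \<Rightarrow> 'a set"
  assumes "compact K" "\<And>i. open (U i)" "K \<subseteq> (\<Union>i<n. U i)"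
  shows "\<exists>L. (\<forall>i<n. compact (L i) \<and> L i \<subseteq> U i) \<and> K = (\<Union>i<n. L i)"
  using assms(1,3)
proof (induction n arbitrary: K)
  case 0
  then show ?case by auto
next
  case (Suc n)
  let ?V = "\<Union>i<n. U i"
  have oV: "open ?V" using assms(2) by auto
  have cA: "closed (K - ?V)" and cB: "closed (K - U n)"
    using compact_imp_closed[OF Suc.prems(1)] oV assms(2) by (simp_all add: closed_Diff)
  have dis: "(K - ?V) \<inter> (K - U n) = {}"
    using Suc.prems(2) by (auto simp: lessThan_Suc)
  obtain S T where ST: "open S" "open T" "K - ?V \<subseteq> S" "K - U n \<subseteq> T" "S \<inter> T = {}"
    using t4_space[OF cA cB dis] by blast
  have c1: "compact (K - S)" using Suc.prems(1) ST(1) by (simp add: compact_diff)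
  have "K - S \<subseteq> ?V" using ST by auto
  from Suc.IH[OF c1 this] obtain L where L: "\<forall>i<n. compact (L i) \<and> L i \<subseteq> U i" "K - S = (\<Union>i<n. L i)"
    by blast
  define L' where "L' i = (if i = n then K - T else L i)" for i
  have "compact (K - T)" using Suc.prems(1) ST(2) by (simp add: compact_diff)
  then have "\<forall>i<Suc n. compact (L' i) \<and> L' i \<subseteq> U i"
    using L ST by (auto simp: L'_def less_Suc_eq)
  moreover have "K = (\<Union>i<Suc n. L' i)"
  proof -
    have "(\<Union>i<Suc n. L' i) = (\<Union>i<n. L i) \<union> (K - T)"
      by (auto simp: L'_def lessThan_Suc)
    then show ?thesis using L(2) ST by auto
  qed
  ultimately show ?case by blast
qed

text \<open>Inner approximation by compact sets followed by outer approximation by open sets gives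
  an outer measure for which open sets are Caratheodory measurable. As \<open>m\<close> is not
  assumed regular, \<open>\<mu>\<close> may differ from \<open>m\<close> on compact sets; this is
  why the conclusion is phrased through open sets.\<close>

lemma compact_content_extends_to_borel_measure:
  fixes m :: "'a::metric_space set \<Rightarrow> ennreal"
  assumes cpt: "compact (UNIV :: 'a set)"
    and empty: "m {} = 0"
    and mono: "\<And>A B. compact A \<Longrightarrow> compact B \<Longrightarrow> A \<subseteq> B \<Longrightarrow> m A \<le> m B"
    and subadd: "\<And>A B. compact A \<Longrightarrow> compact B \<Longrightarrow> m (A \<union> B) \<le> m A + m B"
    and superadd: "\<And>A B. compact A \<Longrightarrow> compact B \<Longrightarrow> A \<inter> B = {} \<Longrightarrow> m A + m B \<le> m (A \<union> B)"
    and finite: "m UNIV < \<infinity>"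
  shows "\<exists>\<mu>. sets \<mu> = sets borel \<and>
    (\<forall>U. open U \<longrightarrow> emeasure \<mu> U = (SUP K\<in>{K. compact K \<and> K \<subseteq> U}. m K)) \<and>
    (\<forall>A\<in>sets borel. emeasure \<mu> A = (INF U\<in>{U. open U \<and> A \<subseteq> U}. emeasure \<mu> U))"
proof -
  define l where "l U = (SUP K\<in>{K. compact K \<and> K \<subseteq> U}. m K)" for U
  define outer where "outer A = (INF U\<in>{U. open U \<and> A \<subseteq> U}. l U)" for A
  have l_ge: "m K \<le> l U" if "compact K" "K \<subseteq> U" for K U
    unfolding l_def by (rule SUP_upper) (use that in auto)
  have l_mono: "l U \<le> l V" if "U \<subseteq> V" for U V
    unfolding l_def by (rule SUP_subset_mono) (use that in auto)
  have l_fin: "l U < \<infinity>" for U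
  proof -
    have "l U \<le> m UNIV"
      unfolding l_def by (rule SUP_least) (use mono cpt in auto)
    then show ?thesis using finite by (rule le_less_trans)
  qed
  have fin_sub: "m (\<Union>i<n. L i) \<le> (\<Sum>i<n. m (L i))" if "\<forall>i<n. compact (L i)" for L and n :: nat
    using that
  proof (induction n)
    case 0
    then show ?case using empty by simp
  next
    case (Suc n)
    have "m (\<Union>i<Suc n. L i) = m ((\<Union>i<n. L i) \<union> L n)"
      by (simp add: lessThan_Suc Un_commute)
    also have "\<dots> \<le> m (\<Union>i<n. L i) + m (L n)"
      by (rule subadd) (use Suc.prems in \<open>auto intro!: compact_UN\<close>)
    also have "\<dots> \<le> (\<Sum>i<Suc n. m (L i))"
      using Suc by (auto intro: add_mono)
    finally show ?case .
  qed
  \<comment> \<open>Compactness reduces the cover of \<open>K\<close> to a finite one; cutting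
    \<open>K\<close> into compact pieces, one inside each open set, makes finite subadditivity of
    \<open>m\<close> applicable.\<close>
  have l_csub: "l (\<Union>i. U i) \<le> (\<Sum>i. l (U i))" if "\<And>i. open (U i)" for U :: "nat \<Rightarrow> 'a set"
    unfolding l_def[of "\<Union>i. U i"]
  proof (rule SUP_least)
    fix K assume "K \<in> {K. compact K \<and> K \<subseteq> (\<Union>i. U i)}"
    then have K: "compact K" "K \<subseteq> (\<Union>i. U i)" by auto
    have "\<exists>C. finite C \<and> K \<subseteq> (\<Union>i\<in>C. U i)"
      by (rule compactE_image[OF K(1), of UNIV U]) (use K(2) that in auto)
    then obtain C where C: "finite C" "K \<subseteq> (\<Union>i\<in>C. U i)" by blast
    obtain n where "C \<subseteq> {..<n}" using C(1) finite_nat_iff_bounded by auto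
    then have "K \<subseteq> (\<Union>i<n. U i)" using C(2) by blast
    from open_cover_closed_pieces[OF K(1) that this] obtain L where
      L: "\<forall>i<n. compact (L i) \<and> L i \<subseteq> U i" "K = (\<Union>i<n. L i)" by blast
    have "m K \<le> (\<Sum>i<n. m (L i))" unfolding L(2) by (rule fin_sub) (use L in auto)
    also have "\<dots> \<le> (\<Sum>i<n. l (U i))" by (rule sum_mono) (use L l_ge in auto)
    also have "\<dots> \<le> (\<Sum>i. l (U i))" by (rule sum_le_suminf) auto
    finally show "m K \<le> (\<Sum>i. l (U i))" .
  qed
  have o_open: "outer U = l U" if "open U" for U
    unfolding outer_def by (rule antisym) (use that l_mono in \<open>auto intro!: INF_lower INF_greatest\<close>)
  have o_le: "outer A \<le> l U" if "open U" "A \<subseteq> U" for A U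
    unfolding outer_def by (rule INF_lower) (use that in auto)
  have o_approx: "\<exists>U. open U \<and> A \<subseteq> U \<and> l U < outer A + e" if "0 < e" for A and e :: ennreal
  proof -
    have "outer A < \<infinity>" using o_le[of UNIV A] l_fin[of UNIV] by (auto intro: le_less_trans)
    then have "outer A < outer A + e" using that by (simp add: ennreal_add_left_cancel_less[of "outer A" 0, simplified])
    then show ?thesis unfolding outer_def INF_less_iff by auto
  qed
  have o_mono: "outer A \<le> outer B" if "A \<subseteq> B" for A B
    unfolding outer_def[of B] by (rule INF_greatest) (use that o_le in auto)
  have o_empty: "outer {} = 0"
  proof -
    have "{K. compact K \<and> K \<subseteq> {}} = {{} :: 'a set}" by auto
    then have "l {} = 0" unfolding l_def using empty by simp
    then show ?thesis using o_open by simp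
  qed
  have o_csub: "outer (\<Union>i. A i) \<le> (\<Sum>i. outer (A i))" for A :: "nat \<Rightarrow> 'a set"
  proof (rule ennreal_le_epsilon)
    fix e :: real assume e: "0 < e"
    have "\<forall>i. \<exists>U. open U \<and> A i \<subseteq> U \<and> l U < outer (A i) + ennreal (e * (1/2) ^ Suc i)"
      using e by (intro allI o_approx) (simp add: zero_less_mult_iff)
    then obtain U where U: "\<And>i. open (U i)" "\<And>i. A i \<subseteq> U i"
      "\<And>i. l (U i) < outer (A i) + ennreal (e * (1/2) ^ Suc i)" by metis
    have "outer (\<Union>i. A i) \<le> l (\<Union>i. U i)" by (rule o_le) (use U in blast)+
    also have "\<dots> \<le> (\<Sum>i. l (U i))" by (rule l_csub) (rule U)
    also have "\<dots> \<le> (\<Sum>i. outer (A i) + ennreal (e * (1/2) ^ Suc i))"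
      using U(3) by (intro suminf_le less_imp_le) auto
    also have "\<dots> = (\<Sum>i. outer (A i)) + (\<Sum>i. ennreal (e * (1/2) ^ Suc i))"
      by (rule suminf_add[symmetric]) auto
    also have "(\<Sum>i. ennreal (e * (1/2) ^ Suc i)) = ennreal e"
    proof (rule suminf_ennreal_eq)
      show "(\<lambda>i. e * (1/2) ^ Suc i) sums e"
        using sums_mult[OF power_half_series, of e] by (simp only: mult_1_right)
      show "0 \<le> e * (1/2) ^ Suc i" for i using e by simp
    qed
    finally show "outer (\<Union>i. A i) \<le> (\<Sum>i. outer (A i)) + ennreal e" .
  qed
  have oms: "outer_measure_space (Pow UNIV) outer"
    unfolding outer_measure_space_def positive_def increasing_def countably_subadditive_def
    using o_empty o_mono o_csub by auto
  interpret P: sigma_algebra "UNIV :: 'a set" "Pow UNIV" by (rule sigma_algebra_Pow)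
  define L where "L = lambda_system UNIV (Pow UNIV) outer"
  have ms: "measure_space UNIV L outer"
    unfolding L_def by (rule P.caratheodory_lemma[OF oms])
  have open_L: "U \<in> L" if U: "open U" for U
  proof -
    \<comment> \<open>Caratheodory's inequality. If \<open>V\<close> is open and contains
      \<open>A\<close>, a compact \<open>K\<close> inside \<open>V \<inter> U\<close> leaves the
      open set \<open>V - K\<close>, which contains \<open>A - U\<close>; superadditivity on
      disjoint compact sets bounds the two masses together by \<open>l V\<close>.\<close>
    have ge: "outer (A \<inter> U) + outer (A - U) \<le> outer A" for A
      unfolding outer_def[of A]
    proof (rule INF_greatest)
      fix V assume "V \<in> {V. open V \<and> A \<subseteq> V}"
      then have V: "open V" "A \<subseteq> V" by auto
      have *: "m K + outer (A - U) \<le> l V" if K: "compact K" "K \<subseteq> V \<inter> U" for K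
      proof -
        have oVK: "open (V - K)" using V K by (auto intro: open_Diff compact_imp_closed)
        have "m K + outer (A - U) \<le> m K + l (V - K)"
          by (intro add_left_mono o_le) (use oVK V K in auto)
        also have "\<dots> = (SUP J\<in>{J. compact J \<and> J \<subseteq> V - K}. m K + m J)"
          unfolding l_def by (rule ennreal_SUP_add_right) auto
        also have "\<dots> \<le> l V"
        proof (rule SUP_least)
          fix J assume "J \<in> {J. compact J \<and> J \<subseteq> V - K}"
          then have J: "compact J" "J \<subseteq> V - K" by auto
          have "m K + m J \<le> m (K \<union> J)" by (rule superadd) (use J K in auto)
          also have "\<dots> \<le> l V" by (rule l_ge) (use J K in auto)
          finally show "m K + m J \<le> l V" .
        qed
        finally show ?thesis .
      qed
      have "outer (A \<inter> U) + outer (A - U) \<le> l (V \<inter> U) + outer (A - U)"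
        by (intro add_right_mono o_le) (use U V in auto)
      also have "\<dots> = (SUP K\<in>{K. compact K \<and> K \<subseteq> V \<inter> U}. m K + outer (A - U))"
        unfolding l_def by (rule ennreal_SUP_add_left[symmetric]) auto
      also have "\<dots> \<le> l V" by (rule SUP_least) (use * in auto)
      finally show "outer (A \<inter> U) + outer (A - U) \<le> l V" .
    qed
    \<comment> \<open>Padding with empty sets derives the inequality for two sets from countable
      subadditivity.\<close>
    have le: "outer A \<le> outer (A \<inter> U) + outer (A - U)" for A
    proof -
      have "outer (\<Union>i. (\<lambda>i::nat. if i = 0 then A \<inter> U else if i = 1 then A - U else {}) i)
        \<le> (\<Sum>i. outer ((\<lambda>i::nat. if i = 0 then A \<inter> U else if i = 1 then A - U else {}) i))"
        by (rule o_csub)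
      also have "\<dots> = (\<Sum>i\<in>{0,1}. outer ((\<lambda>i::nat. if i = 0 then A \<inter> U else if i = 1 then A - U else {}) i))"
        by (rule suminf_finite) (auto simp: o_empty)
      also have "\<dots> = outer (A \<inter> U) + outer (A - U)" by simp
      also have "(\<Union>i. (\<lambda>i::nat. if i = 0 then A \<inter> U else if i = 1 then A - U else {}) i) = A"
        by (auto split: if_splits)
      finally show ?thesis .
    qed
    show ?thesis
      unfolding L_def P.lambda_system_eq using ge le by (auto intro: antisym)
  qed
  have borel_L: "sets borel \<subseteq> L"
  proof -
    have "sigma_algebra UNIV L" using ms by (simp add: measure_space_def)
    then have "sigma_sets UNIV {S. open S} \<subseteq> L"
      by (rule sigma_algebra.sigma_sets_subset) (use open_L in auto)
    then show ?thesis by (simp add: borel_def)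
  qed
  define \<mu> where "\<mu> = measure_of UNIV (sets borel) outer"
  have sa: "sigma_algebra (UNIV :: 'a set) (sets borel)"
    using sets.sigma_algebra_axioms[of borel] by simp
  have ms': "measure_space UNIV (sets borel) outer"
    by (rule measure_down[OF ms sa borel_L])
  have sets: "sets \<mu> = sets borel"
    unfolding \<mu>_def by (simp add: sa sigma_algebra.sigma_sets_eq)
  have em: "emeasure \<mu> A = outer A" if "A \<in> sets borel" for A
    unfolding \<mu>_def by (rule emeasure_measure_of_sigma) (use ms' that in \<open>auto simp: measure_space_def\<close>)
  show ?thesis
  proof (intro exI[of _ \<mu>] conjI allI impI ballI)
    show "sets \<mu> = sets borel" by (rule sets)
    show "emeasure \<mu> U = (SUP K\<in>{K. compact K \<and> K \<subseteq> U}. m K)" if "open U" for U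
      using that em[of U] o_open[of U] by (simp add: l_def)
    show "emeasure \<mu> A = (INF U\<in>{U. open U \<and> A \<subseteq> U}. emeasure \<mu> U)" if "A \<in> sets borel" for A
      unfolding em[OF that] outer_def by (rule INF_cong) (auto simp: em o_open)
  qed
qed

section \<open>Limits along filters\<close>

text \<open>Tychonoff's theorem gives a cluster point \<open>m\<close> of \<open>f\<close> in a
  product of intervals. The index type will be that of all subsets of M, where a convergent
  subsequence need not exist; hence a filter finer than \<open>sequentially\<close>.\<close>

lemma pointwise_convergent_along_filter:
  fixes f :: "nat \<Rightarrow> 'b \<Rightarrow> real"
  assumes "\<And>n A. f n A \<in> {a..b}"
  shows "\<exists>F m. F \<noteq> bot \<and> F \<le> sequentially \<and> (\<forall>A. ((\<lambda>n. f n A) \<longlongrightarrow> m A) F)"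
proof -
  have "compactin (product_topology (\<lambda>_. euclidean) UNIV) (PiE (UNIV :: 'b set) (\<lambda>_. {a..b}))"
    by (subst compactin_PiE) auto
  then have cpt: "compact (PiE (UNIV :: 'b set) (\<lambda>_. {a..b}))"
    by (simp add: euclidean_product_topology)
  have "filtermap f sequentially \<noteq> bot" by (simp add: filtermap_bot_iff)
  moreover have "eventually (\<lambda>x. x \<in> PiE UNIV (\<lambda>_. {a..b})) (filtermap f sequentially)"
    using assms by (simp add: eventually_filtermap PiE_iff)
  ultimately obtain m where m: "inf (nhds m) (filtermap f sequentially) \<noteq> bot"
    using cpt unfolding compact_filter by blast
  define F where "F = inf sequentially (filtercomap f (nhds m))"
  \<comment> \<open>If \<open>F\<close> were trivial, some neighbourhood of \<open>m\<close> would
    miss a tail of \<open>f\<close>, contrary to \<open>m\<close> being a cluster point.\<close>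
  have "F \<noteq> bot"
  proof
    assume "F = bot"
    then have "eventually (\<lambda>_. False) F" by simp
    then obtain P Q where PQ: "eventually P sequentially" "eventually Q (filtercomap f (nhds m))"
      "\<And>x. P x \<Longrightarrow> Q x \<Longrightarrow> False"
      unfolding F_def eventually_inf by blast
    then obtain R where R: "eventually R (nhds m)" "\<And>x. R (f x) \<Longrightarrow> Q x"
      unfolding eventually_filtercomap by blast
    have "eventually (\<lambda>y. \<not> R y) (filtermap f sequentially)"
      unfolding eventually_filtermap using PQ(1) by eventually_elim (use PQ(3) R(2) in blast)
    then have "eventually (\<lambda>_. False) (inf (nhds m) (filtermap f sequentially))"
      unfolding eventually_inf using R(1) by blast
    then show False using m by (simp add: trivial_limit_def)
  qed
  moreover have "F \<le> sequentially" by (simp add: F_def)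
  moreover have "((\<lambda>n. f n A) \<longlongrightarrow> m A) F" for A
  proof -
    have "(f \<longlongrightarrow> m) F"
      unfolding filterlim_def F_def by (meson filtermap_filtercomap filtermap_mono inf_le2 order_trans)
    moreover have "((\<lambda>g. g A) \<longlongrightarrow> m A) (nhds m)"
      using continuous_on_product_coordinates[of A]
      by (metis UNIV_I continuous_on_def at_within_open_NO_MATCH continuous_on_eq_continuous_at isCont_def open_UNIV tendsto_at_iff_tendsto_nhds)
    ultimately show ?thesis by (rule filterlim_compose[rotated])
  qed
  ultimately show ?thesis by blast
qed

section \<open>The compactification\<close>

lemma loc_unif_to_const_pointwise:
  assumes "loc_unif_to_const euclidean A f x" "p \<in> A"
  shows "(\<lambda>n. f n p) \<longlonglongrightarrow> x"
proof (rule topological_tendstoI)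
  fix U assume "open U" "x \<in> U"
  moreover obtain W where "p \<in> W"
    "\<And>U. open U \<Longrightarrow> x \<in> U \<Longrightarrow> \<forall>\<^sub>F n in sequentially. f n ` (W \<inter> A) \<subseteq> U"
    using assms unfolding loc_unif_to_const_def open_openin[symmetric] by metis
  ultimately have "\<forall>\<^sub>F n in sequentially. f n ` (W \<inter> A) \<subseteq> U" by blast
  then show "\<forall>\<^sub>F n in sequentially. f n p \<in> U"
    by eventually_elim (use \<open>p \<in> W\<close> assms(2) in blast)
qed

text \<open>Finitely many of the neighbourhoods in the definition cover a compact set, and finitely
  many eventual statements hold simultaneously.\<close>

lemma loc_unif_to_const_compactin:
  assumes "loc_unif_to_const X A f x" "compactin X C" "C \<subseteq> A" "openin X U" "x \<in> U"
  shows "\<forall>\<^sub>F n in sequentially. f n ` C \<subseteq> U"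
proof -
  have "\<forall>p\<in>A. \<exists>W. openin X W \<and> p \<in> W \<and> (\<forall>\<^sub>F n in sequentially. f n ` (W \<inter> A) \<subseteq> U)"
    using assms(1,4,5) unfolding loc_unif_to_const_def by blast
  then obtain W where W: "\<And>p. p \<in> A \<Longrightarrow> openin X (W p)" "\<And>p. p \<in> A \<Longrightarrow> p \<in> W p"
    "\<And>p. p \<in> A \<Longrightarrow> \<forall>\<^sub>F n in sequentially. f n ` (W p \<inter> A) \<subseteq> U" by metis
  have "\<exists>\<F>. finite \<F> \<and> \<F> \<subseteq> W ` C \<and> C \<subseteq> \<Union>\<F>"
  proof (rule compactinD[OF assms(2)])
    show "openin X V" if "V \<in> W ` C" for V using W(1) assms(3) that by blast
    show "C \<subseteq> \<Union> (W ` C)" using W(2) assms(3) by blast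
  qed
  then obtain D where D: "finite D" "D \<subseteq> C" "C \<subseteq> (\<Union>p\<in>D. W p)"
    by (metis finite_subset_image)
  have "\<forall>\<^sub>F n in sequentially. \<forall>p\<in>D. f n ` (W p \<inter> A) \<subseteq> U"
    using D assms(3) W(3) by (intro eventually_ball_finite) auto
  then show ?thesis
    by eventually_elim (use D(3) assms(3) in blast)
qed

lemma group_homeo_group: "group (homeo_group :: ('m::topological_space \<Rightarrow> 'm) monoid)"
proof (rule groupI)
  fix x :: "'m \<Rightarrow> 'm" assume "x \<in> carrier homeo_group"
  then obtain g where "homeomorphic_maps euclidean euclidean x g"
    unfolding homeo_group_def homeomorphic_map_maps by auto
  then show "\<exists>y\<in>carrier homeo_group. y \<otimes>\<^bsub>homeo_group\<^esub> x = \<one>\<^bsub>homeo_group\<^esub>"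
    by (intro bexI[of _ g]) (auto simp: homeo_group_def homeomorphic_maps_map fun_eq_iff)
qed (auto simp: homeo_group_def homeomorphic_map_id intro: homeomorphic_map_compose)

locale compactified_convergence_group =
  fixes \<Gamma> :: "('m::metric_space \<Rightarrow> 'm) set"
    and d :: "('m \<Rightarrow> 'm) + 'm \<Rightarrow> ('m \<Rightarrow> 'm) + 'm \<Rightarrow> real"
  assumes compact_M: "compact (UNIV :: 'm set)"
    and conv_group: "convergence_group \<Gamma>"
    and non_elem: "non_elementary \<Gamma>"
    and compat: "compatible_metric \<Gamma> d"
begin

abbreviation iv :: "('m \<Rightarrow> 'm) \<Rightarrow> 'm \<Rightarrow> 'm" where
  "iv g \<equiv> inv\<^bsub>homeo_group\<^esub> g"

sublocale Metric_space "\<Gamma> <+> UNIV" d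
  using compat by (simp add: compatible_metric_def)

section \<open>Elements of the group and their inverses\<close>

lemma Inl_mem [simp]: "Inl g \<in> \<Gamma> <+> (UNIV :: 'm set) \<longleftrightarrow> g \<in> \<Gamma>"
  and Inr_mem [simp]: "Inr p \<in> \<Gamma> <+> (UNIV :: 'm set)"
  by auto

lemma subgroup_\<Gamma>: "subgroup \<Gamma> homeo_group"
  using conv_group by (simp add: convergence_group_def)

lemma homeo: "g \<in> \<Gamma> \<Longrightarrow> homeomorphic_map euclidean euclidean g"
  using subgroup.subset[OF subgroup_\<Gamma>] by (auto simp: homeo_group_def)

lemma id_mem [simp]: "id \<in> \<Gamma>"
  using subgroup.one_closed[OF subgroup_\<Gamma>] by (simp add: homeo_group_def)

lemma comp_mem [simp]: "g \<in> \<Gamma> \<Longrightarrow> h \<in> \<Gamma> \<Longrightarrow> g \<circ> h \<in> \<Gamma>"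
  using subgroup.m_closed[OF subgroup_\<Gamma>, of g h] by (simp add: homeo_group_def)

lemma iv_mem [simp]: "g \<in> \<Gamma> \<Longrightarrow> iv g \<in> \<Gamma>"
  using subgroup.m_inv_closed[OF subgroup_\<Gamma>] by blast

lemma comp_iv [simp]: assumes "g \<in> \<Gamma>" shows "g \<circ> iv g = id" "iv g \<circ> g = id"
proof -
  have "g \<in> carrier homeo_group" using assms subgroup.subset[OF subgroup_\<Gamma>] by blast
  from group.r_inv[OF group_homeo_group this] group.l_inv[OF group_homeo_group this]
  show "g \<circ> iv g = id" "iv g \<circ> g = id" by (simp_all add: homeo_group_def)
qed

lemma iv_apply [simp]: assumes "g \<in> \<Gamma>" shows "g (iv g p) = p" "iv g (g p) = p"
  using comp_iv[OF assms] by (simp_all add: fun_eq_iff)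

lemma iv_iv [simp]: "g \<in> \<Gamma> \<Longrightarrow> iv (iv g) = g"
  using group.inv_inv[OF group_homeo_group] subgroup.subset[OF subgroup_\<Gamma>] by blast

lemma iv_comp: assumes "g \<in> \<Gamma>" "h \<in> \<Gamma>" shows "iv (g \<circ> h) = iv h \<circ> iv g"
proof
  fix p
  have "iv (g \<circ> h) ((g \<circ> h) (iv h (iv g p))) = iv h (iv g p)"
    using assms by (intro iv_apply(2)) simp
  then show "iv (g \<circ> h) p = (iv h \<circ> iv g) p" using assms by simp
qed

section \<open>Topology of the compactification\<close>

lemma compact_X: "compact_space mtopology"
  and emb_Inl: "embedding_map (discrete_topology \<Gamma>) mtopology Inl"
  and emb_Inr: "embedding_map euclidean mtopology Inr"
  and action_X: "convergence_action mtopology \<Gamma> (\<lambda>\<gamma>. map_sum (\<lambda>\<eta>. \<gamma> \<circ> \<eta>) \<gamma>)"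
  using compat by (auto simp: compatible_metric_def compactification_def)

lemma continuous_Inr: "continuous_map euclidean mtopology Inr"
  using emb_Inr homeomorphic_imp_continuous_map continuous_map_in_subtopology
  unfolding embedding_map_def by blast

lemma closedin_range_Inr: "closedin mtopology (range Inr)"
proof -
  have "compactin mtopology (Inr ` UNIV)"
  proof (rule image_compactin)
    show "compactin euclidean (UNIV :: 'm set)" using compact_M by simp
    show "continuous_map euclidean mtopology Inr"
      by (rule continuous_Inr)
  qed
  then show ?thesis by (rule compactin_imp_closedin[OF Hausdorff_space_mtopology])
qed

text \<open>The copy of \<open>\<Gamma>\<close> is discrete in itself and is open as the complement
  of the compact copy of M, so its points are isolated.\<close>

lemma openin_Inl: assumes "\<beta> \<in> \<Gamma>" shows "openin mtopology {Inl \<beta>}"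
proof -
  have eq: "(\<Gamma> <+> UNIV) - range Inr = Inl ` \<Gamma>" by auto
  have o: "openin mtopology (Inl ` \<Gamma>)"
    using openin_diff[OF open_in_mspace closedin_range_Inr] unfolding eq .
  have "open_map (discrete_topology \<Gamma>) (subtopology mtopology (Inl ` \<Gamma>)) Inl"
    using emb_Inl by (simp add: embedding_map_def homeomorphic_eq_everything_map)
  then have "openin (subtopology mtopology (Inl ` \<Gamma>)) (Inl ` {\<beta>})"
    unfolding open_map_def using assms by (metis openin_discrete_topology empty_subsetI insert_subset)
  then show ?thesis using openin_trans_full[OF _ o] by simp
qed

lemma openin_Inr_image:
  assumes "open U" shows "\<exists>V. openin mtopology V \<and> (\<forall>p. Inr p \<in> V \<longleftrightarrow> p \<in> U)"
proof -
  have "open_map euclidean (subtopology mtopology (range Inr)) Inr"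
    using emb_Inr by (simp add: embedding_map_def homeomorphic_eq_everything_map)
  then have "openin (subtopology mtopology (range Inr)) (Inr ` U)"
    using assms unfolding open_map_def by simp
  then obtain V where "openin mtopology V" "Inr ` U = V \<inter> range Inr"
    unfolding openin_subtopology by blast
  then show ?thesis by (intro exI[of _ V]) auto
qed

lemma open_Inr_vimage: assumes "openin mtopology V" shows "open {p. Inr p \<in> V}"
  using openin_continuous_map_preimage[OF continuous_Inr assms] by simp

section \<open>Non-elementarity, convergent sequences and the limit set\<close>

lemma three_points: "\<exists>P :: 'm set. finite P \<and> card P = 3"
proof -
  have "\<exists>P \<subseteq> limit_set \<Gamma>. finite P \<and> card P = 3"
  proof (cases "finite (limit_set \<Gamma>)")
    case True
    then show ?thesis using non_elem obtain_subset_with_card_n[of 3 "limit_set \<Gamma>"]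
      unfolding non_elementary_def by metis
  qed (metis infinite_arbitrarily_large)
  then show ?thesis by blast
qed

lemma point_avoiding_two: "\<exists>p::'m. p \<noteq> a \<and> p \<noteq> b"
proof -
  obtain P :: "'m set" where P: "finite P" "card P = 3" using three_points by blast
  have "\<not> P \<subseteq> {a, b}"
    using card_mono[of "{a,b}" P] P card_insert_le_m1[of 2 "{b}" a] by auto
  then show ?thesis by blast
qed

text \<open>Cancelling \<open>\<eta>\<close> on the right would make the injective sequence constant
  along a tail. This excludes an attracting point inside \<open>\<Gamma>\<close> in
  \<open>convergence_subsequence\<close>.\<close>

lemma injective_translates_not_eventually_const:
  assumes "inj g" "range g \<subseteq> \<Gamma>" "\<eta> \<in> \<Gamma>" "strict_mono r"
  shows "\<not> (\<forall>\<^sub>F j in sequentially. g (r j) \<circ> \<eta> = \<beta>)"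
proof
  assume "\<forall>\<^sub>F j in sequentially. g (r j) \<circ> \<eta> = \<beta>"
  then obtain N where N: "\<And>j. j \<ge> N \<Longrightarrow> g (r j) \<circ> \<eta> = \<beta>"
    unfolding eventually_sequentially by blast
  have "g (r N) \<circ> (\<eta> \<circ> iv \<eta>) = g (r (Suc N)) \<circ> (\<eta> \<circ> iv \<eta>)"
    using N[of N] N[of "Suc N"] by (metis comp_assoc le_refl le_Suc_eq)
  then have "g (r N) = g (r (Suc N))" using assms(3) by simp
  then have "r N = r (Suc N)" using assms(1) by (simp add: inj_eq)
  then show False using assms(4) by (metis lessI less_irrefl strict_monoD)
qed

text \<open>The convergence property on the compactification provides an attracting and a repelling
  point there. Both turn out to lie in M, and evaluating the convergence at points of M, at group
  elements and at inverses gives the three conclusions.\<close>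

lemma convergence_subsequence:
  assumes inj: "inj g" and ran: "range g \<subseteq> \<Gamma>"
  shows "\<exists>r x y. strict_mono (r :: nat \<Rightarrow> nat) \<and>
    loc_unif_to_const euclidean (UNIV - {y}) (\<lambda>j. g (r j)) x \<and>
    (\<forall>\<eta>\<in>\<Gamma>. (\<lambda>j. d (Inl (g (r j) \<circ> \<eta>)) (Inr x)) \<longlonglongrightarrow> 0) \<and>
    (\<lambda>j. d (Inl (iv (g (r j)))) (Inr y)) \<longlonglongrightarrow> 0"
proof -
  let ?T = "\<Gamma> <+> (UNIV :: 'm set)"
  let ?\<phi> = "\<lambda>\<gamma>. map_sum (\<lambda>\<eta>. \<gamma> \<circ> \<eta>) \<gamma>"
  obtain x' y' r where x': "x' \<in> ?T" and y': "y' \<in> ?T" and r: "strict_mono (r :: nat \<Rightarrow> nat)"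
    and lu: "loc_unif_to_const mtopology (?T - {y'}) (\<lambda>j. ?\<phi> (g (r j))) x'"
    using action_X inj ran unfolding convergence_action_def topspace_mtopology by blast
  have gm: "g n \<in> \<Gamma>" for n using ran by auto
  have inf: "infinite \<Gamma>" using inj ran finite_subset range_inj_infinite by blast
  have pt: "\<forall>\<^sub>F j in sequentially. ?\<phi> (g (r j)) q \<in> U"
    if "q \<in> ?T" "q \<noteq> y'" "openin mtopology U" "x' \<in> U" for q U
  proof -
    have "\<forall>\<^sub>F j in sequentially. ?\<phi> (g (r j)) ` {q} \<subseteq> U"
      by (rule loc_unif_to_const_compactin[OF lu]) (use that in auto)
    then show ?thesis by simp
  qed
  \<comment> \<open>A group element is isolated, so as attracting point it would force the
    translates of some \<open>\<eta>\<close> to be eventually constant.\<close>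
  have "x' \<in> range Inr"
  proof (rule ccontr)
    assume "x' \<notin> range Inr"
    then obtain \<beta> where \<beta>: "\<beta> \<in> \<Gamma>" "x' = Inl \<beta>" using x' by auto
    have "infinite (\<Gamma> - {\<eta>. Inl \<eta> = y'})"
    proof (rule Diff_infinite_finite[OF _ inf])
      show "finite {\<eta>. Inl \<eta> = y'}" by (cases y') auto
    qed
    then obtain \<eta> where \<eta>: "\<eta> \<in> \<Gamma>" "Inl \<eta> \<noteq> y'"
      by (metis (mono_tags, lifting) Diff_iff all_not_in_conv finite.emptyI mem_Collect_eq)
    have "\<forall>\<^sub>F j in sequentially. ?\<phi> (g (r j)) (Inl \<eta>) \<in> {Inl \<beta>}"
      by (rule pt) (use \<eta> \<beta> openin_Inl in auto)
    then show False using injective_translates_not_eventually_const[OF inj ran \<eta>(1) r, of \<beta>] by simp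
  qed
  then obtain x where x: "x' = Inr x" by auto
  \<comment> \<open>If the repelling point were isolated, its complement would be compact and the
    convergence uniform there. As this complement contains M, which each group element maps onto
    itself, \<open>p \<noteq> x\<close> would be attained forever.\<close>
  have "y' \<in> range Inr"
  proof (rule ccontr)
    assume "y' \<notin> range Inr"
    then obtain \<beta> where \<beta>: "\<beta> \<in> \<Gamma>" "y' = Inl \<beta>" using y' by auto
    obtain p where p: "p \<noteq> x" using point_avoiding_two by blast
    obtain q where q: "q \<noteq> x" "q \<noteq> p" using point_avoiding_two by blast
    have "\<forall>\<^sub>F j in sequentially. ?\<phi> (g (r j)) ` (?T - {y'}) \<subseteq> ?T - {Inr p, Inr q}"
    proof (rule loc_unif_to_const_compactin[OF lu])
      show "compactin mtopology (?T - {y'})"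
        using openin_Inl[OF \<beta>(1)] \<beta>(2) compact_X
        by (intro closedin_compact_space) (auto intro: closedin_diff)
      have "closedin mtopology {Inr p, Inr q}"
        by (rule closedin_Hausdorff_finite[OF Hausdorff_space_mtopology]) auto
      then show "openin mtopology (?T - {Inr p, Inr q})" by (intro openin_diff) auto
    qed (use x p q in auto)
    from eventually_happens'[OF sequentially_bot this]
    obtain j where j: "?\<phi> (g (r j)) ` (?T - {y'}) \<subseteq> ?T - {Inr p, Inr q}" ..
    have "?\<phi> (g (r j)) (Inr (iv (g (r j)) p)) = Inr p" using gm by simp
    moreover have "Inr (iv (g (r j)) p) \<in> ?T - {y'}" using \<beta> by auto
    ultimately show False using j by (metis Diff_iff image_subset_iff insertI1)
  qed
  then obtain y where y: "y' = Inr y" by auto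
  have lu_M: "loc_unif_to_const euclidean (UNIV - {y}) (\<lambda>j. g (r j)) x"
    unfolding loc_unif_to_const_def open_openin[symmetric]
  proof
    fix p assume p: "p \<in> UNIV - {y}"
    then have "Inr p \<in> ?T - {y'}" using y by auto
    then obtain W where W: "openin mtopology W" "Inr p \<in> W"
      "\<forall>U. openin mtopology U \<and> x' \<in> U \<longrightarrow>
        (\<forall>\<^sub>F n in sequentially. ?\<phi> (g (r n)) ` (W \<inter> (?T - {y'})) \<subseteq> U)"
      using bspec[OF lu[unfolded loc_unif_to_const_def]] by blast
    show "\<exists>W. open W \<and> p \<in> W \<and> (\<forall>U. open U \<and> x \<in> U \<longrightarrow>
      (\<forall>\<^sub>F n in sequentially. g (r n) ` (W \<inter> (UNIV - {y})) \<subseteq> U))"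
    proof (intro exI[of _ "{p. Inr p \<in> W}"] conjI allI impI)
      show "open {p. Inr p \<in> W}" by (rule open_Inr_vimage[OF W(1)])
      show "p \<in> {p. Inr p \<in> W}" using W(2) by simp
      fix U assume U: "open U \<and> x \<in> U"
      then obtain V where V: "openin mtopology V" "\<And>p. Inr p \<in> V \<longleftrightarrow> p \<in> U"
        using openin_Inr_image by blast
      have "\<forall>\<^sub>F n in sequentially. ?\<phi> (g (r n)) ` (W \<inter> (?T - {y'})) \<subseteq> V"
        using W(3) V U x by blast
      then show "\<forall>\<^sub>F n in sequentially. g (r n) ` ({p. Inr p \<in> W} \<inter> (UNIV - {y})) \<subseteq> U"
      proof eventually_elim
        case (elim n)
        show ?case
        proof
          fix u assume "u \<in> g (r n) ` ({p. Inr p \<in> W} \<inter> (UNIV - {y}))"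
          then obtain q where q: "Inr q \<in> W" "q \<noteq> y" "u = g (r n) q" by auto
          then have "?\<phi> (g (r n)) (Inr q) \<in> V" using elim y by blast
          then show "u \<in> U" using q V(2) by simp
        qed
      qed
    qed
  qed
  have dzero: "d (Inr p) (Inr p) = 0" for p by (rule mdist_zero) auto
  have "(\<lambda>j. d (Inl (g (r j) \<circ> \<eta>)) (Inr x)) \<longlonglongrightarrow> 0" if \<eta>: "\<eta> \<in> \<Gamma>" for \<eta>
  proof (rule tendstoI)
    fix e :: real assume e: "0 < e"
    have "\<forall>\<^sub>F j in sequentially. ?\<phi> (g (r j)) (Inl \<eta>) \<in> mball (Inr x) e"
      by (rule pt) (use \<eta> y x e dzero in auto)
    then show "\<forall>\<^sub>F j in sequentially. dist (d (Inl (g (r j) \<circ> \<eta>)) (Inr x)) 0 < e"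
      by eventually_elim (simp add: commute)
  qed
  \<comment> \<open>Each \<open>g (r j)\<close> sends its inverse to \<open>id\<close>. Outside a
    ball about the repelling point the images eventually avoid \<open>id\<close>, so the inverse
    must lie in that ball.\<close>
  moreover have "(\<lambda>j. d (Inl (iv (g (r j)))) (Inr y)) \<longlonglongrightarrow> 0"
  proof (rule tendstoI)
    fix e :: real assume e: "0 < e"
    have "\<forall>\<^sub>F j in sequentially. ?\<phi> (g (r j)) ` (?T - mball (Inr y) e) \<subseteq> ?T - {Inl id}"
    proof (rule loc_unif_to_const_compactin[OF lu])
      show "compactin mtopology (?T - mball (Inr y) e)"
        using compact_X by (intro closedin_compact_space) (auto intro: closedin_diff)
      have "closedin mtopology {Inl id}"
        by (rule closedin_Hausdorff_finite[OF Hausdorff_space_mtopology]) auto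
      then show "openin mtopology (?T - {Inl id})" by (intro openin_diff) auto
    qed (use x y e dzero in auto)
    then show "\<forall>\<^sub>F j in sequentially. dist (d (Inl (iv (g (r j)))) (Inr y)) 0 < e"
    proof eventually_elim
      case (elim j)
      have "?\<phi> (g (r j)) (Inl (iv (g (r j)))) = Inl id" using gm by simp
      then have "Inl (iv (g (r j))) \<notin> ?T - mball (Inr y) e" using elim by blast
      then show ?case using gm by (simp add: commute)
    qed
  qed
  ultimately show ?thesis using r lu_M by blast
qed

text \<open>In a finite group, a sequence defining a limit point takes some value
  \<open>g n0\<close> infinitely often, which makes \<open>g n0\<close> constant off one point. The
  complement of that point still contains two points, against injectivity.\<close>

lemma infinite_\<Gamma>: "infinite \<Gamma>"
proof
  assume fin: "finite \<Gamma>"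
  have "limit_set \<Gamma> \<noteq> {}" using non_elem unfolding non_elementary_def by auto
  then obtain x y and g :: "nat \<Rightarrow> 'm \<Rightarrow> 'm" where
    g: "range g \<subseteq> \<Gamma>" "loc_unif_to_const euclidean (UNIV - {y}) g x"
    unfolding limit_set_def by auto
  have "finite (range g)" using fin g(1) finite_subset by blast
  then obtain n0 where n0: "infinite {n. g n = g n0}"
    using pigeonhole_infinite[of UNIV g] by auto
  have *: "g n0 p = x" if "p \<noteq> y" for p
  proof -
    have "(\<lambda>n. g n p) \<longlonglongrightarrow> x"
      by (rule loc_unif_to_const_pointwise[OF g(2)]) (use that in simp)
    moreover have "strict_mono (enumerate {n. g n = g n0})"
      using n0 by (rule strict_mono_enumerate)
    ultimately have "(\<lambda>n. g (enumerate {n. g n = g n0} n) p) \<longlonglongrightarrow> x"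
      using LIMSEQ_subseq_LIMSEQ[of "\<lambda>n. g n p" x "enumerate {n. g n = g n0}"] by (simp add: o_def)
    moreover have "g (enumerate {n. g n = g n0} n) = g n0" for n
      using enumerate_in_set[OF n0] by simp
    ultimately show ?thesis by (simp add: LIMSEQ_const_iff)
  qed
  obtain p where p: "p \<noteq> y" using point_avoiding_two by blast
  obtain q where q: "q \<noteq> y" "q \<noteq> p" using point_avoiding_two by blast
  have "g n0 \<in> \<Gamma>" using g(1) by auto
  then have "p = q" using *[OF p] *[OF q(1)] by (metis iv_apply(2))
  then show False using q by simp
qed

text \<open>The form used to prove finiteness: a supposedly infinite exceptional set yields an
  injective sequence inside it with attracting and repelling points.\<close>

lemma convergence_sequence_in:
  assumes "infinite S" "S \<subseteq> \<Gamma>"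
  obtains g x y where "inj (g :: nat \<Rightarrow> _)" "range g \<subseteq> S"
    "loc_unif_to_const euclidean (UNIV - {y}) g x"
    "\<forall>\<eta>\<in>\<Gamma>. (\<lambda>j. d (Inl (g j \<circ> \<eta>)) (Inr x)) \<longlonglongrightarrow> 0"
    "(\<lambda>j. d (Inl (iv (g j))) (Inr y)) \<longlonglongrightarrow> 0"
proof -
  obtain h :: "nat \<Rightarrow> 'm \<Rightarrow> 'm" where h: "inj h" "range h \<subseteq> S"
    using infinite_countable_subset[OF assms(1)] by blast
  obtain r x y where r: "strict_mono (r :: nat \<Rightarrow> nat)"
    and *: "loc_unif_to_const euclidean (UNIV - {y}) (\<lambda>j. h (r j)) x"
    "(\<forall>\<eta>\<in>\<Gamma>. (\<lambda>j. d (Inl (h (r j) \<circ> \<eta>)) (Inr x)) \<longlonglongrightarrow> 0)"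
    "(\<lambda>j. d (Inl (iv (h (r j)))) (Inr y)) \<longlonglongrightarrow> 0"
    using convergence_subsequence[OF h(1)] h(2) assms(2) by (meson order_trans)
  show ?thesis
  proof (rule that[of "\<lambda>j. h (r j)" y x])
    show "inj (\<lambda>j. h (r j))"
      using inj_compose[OF h(1) strict_mono_imp_inj_on[OF r]] by (simp add: o_def)
    show "range (\<lambda>j. h (r j)) \<subseteq> S" using h(2) by auto
  qed (use * in auto)
qed

text \<open>Along a convergent sequence, \<open>g j\<close> and \<open>g j \<circ> \<alpha>\<close>
  tend to the same attracting point, so their distance cannot stay above \<open>e\<close>.\<close>

lemma right_translation_displacement_finite:
  assumes "\<alpha> \<in> \<Gamma>" "0 < e"
  shows "finite {h\<in>\<Gamma>. d (Inl (iv h \<circ> \<alpha>)) (Inl (iv h)) \<ge> e}"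
proof (rule ccontr)
  define S where "S = {h\<in>\<Gamma>. d (Inl (iv h \<circ> \<alpha>)) (Inl (iv h)) \<ge> e}"
  assume "infinite {h\<in>\<Gamma>. d (Inl (iv h \<circ> \<alpha>)) (Inl (iv h)) \<ge> e}"
  moreover have "inj_on iv S"
    by (rule inj_onI) (metis (no_types, lifting) S_def iv_iv mem_Collect_eq)
  \<comment> \<open>The displacement is measured at \<open>iv h\<close>, so the sequence is
    extracted from the inverses.\<close>
  ultimately have "infinite (iv ` S)" by (simp add: S_def finite_image_iff)
  moreover have "iv ` S \<subseteq> \<Gamma>" by (auto simp: S_def)
  ultimately obtain g x y where "inj (g :: nat \<Rightarrow> _)" and g: "range g \<subseteq> iv ` S"
    and "loc_unif_to_const euclidean (UNIV - {y}) g x"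
    and l: "\<forall>\<eta>\<in>\<Gamma>. (\<lambda>j. d (Inl (g j \<circ> \<eta>)) (Inr x)) \<longlonglongrightarrow> 0"
    and "(\<lambda>j. d (Inl (iv (g j))) (Inr y)) \<longlonglongrightarrow> 0"
    by (rule convergence_sequence_in)
  have S: "d (Inl (g j \<circ> \<alpha>)) (Inl (g j)) \<ge> e" "g j \<in> \<Gamma>" for j
  proof -
    have "g j \<in> iv ` S" using g by blast
    then show "d (Inl (g j \<circ> \<alpha>)) (Inl (g j)) \<ge> e" "g j \<in> \<Gamma>" by (auto simp: S_def)
  qed
  have "(\<lambda>j. d (Inl (g j \<circ> \<alpha>)) (Inr x) + d (Inl (g j \<circ> id)) (Inr x)) \<longlonglongrightarrow> 0 + 0"
    by (intro tendsto_add l[rule_format] assms id_mem)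
  then have "\<forall>\<^sub>F j in sequentially. d (Inl (g j \<circ> \<alpha>)) (Inr x) + d (Inl (g j \<circ> id)) (Inr x) < e"
    using assms(2) by (auto dest: order_tendstoD)
  then obtain j where "d (Inl (g j \<circ> \<alpha>)) (Inr x) + d (Inl (g j)) (Inr x) < e"
    by (auto simp: eventually_sequentially)
  moreover have "d (Inl (g j \<circ> \<alpha>)) (Inl (g j)) \<le> d (Inl (g j \<circ> \<alpha>)) (Inr x) + d (Inr x) (Inl (g j))"
    by (rule triangle) (use S assms in auto)
  ultimately show False using S(1)[of j] by (simp add: commute)
qed

text \<open>In both directions the given sequence is replaced by an injective one with values in its
  range; the convergence property applies to that one, and its attracting point is identified with
  the given point. The metric description yields closedness and serves to recognise limit points
  later.\<close>

lemma limit_set_eq: "limit_set \<Gamma> = {x. \<forall>e>0. \<exists>g\<in>\<Gamma>. d (Inl g) (Inr x) < e}" (is "_ = ?R")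
proof (intro equalityI subsetI)
  fix x assume "x \<in> limit_set \<Gamma>"
  then obtain y and g :: "nat \<Rightarrow> 'm \<Rightarrow> 'm" where
    g: "range g \<subseteq> \<Gamma>" "loc_unif_to_const euclidean (UNIV - {y}) g x"
    unfolding limit_set_def by auto
  \<comment> \<open>The definition of the limit set allows repetitions. A value taken infinitely
    often would be constant off \<open>y\<close>, which is impossible for a bijection of M.\<close>
  have inf: "infinite (range g)"
  proof
    assume "finite (range g)"
    then obtain n0 where n0: "infinite {n. g n = g n0}"
      using pigeonhole_infinite[of UNIV g] by auto
    have *: "g n0 p = x" if "p \<noteq> y" for p
    proof (rule ccontr)
      assume ne: "g n0 p \<noteq> x"
      have "(\<lambda>n. g n p) \<longlonglongrightarrow> x"
        by (rule loc_unif_to_const_pointwise[OF g(2)]) (use that in simp)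
      then have "\<forall>\<^sub>F n in sequentially. g n p \<in> - {g n0 p}"
        by (rule topological_tendstoD) (use ne in auto)
      then have "finite {n. \<not> g n p \<in> - {g n0 p}}"
        unfolding cofinite_eq_sequentially[symmetric] eventually_cofinite .
      moreover have "{n. g n = g n0} \<subseteq> {n. \<not> g n p \<in> - {g n0 p}}" by auto
      ultimately show False using n0 finite_subset by blast
    qed
    obtain p where p: "p \<noteq> y" using point_avoiding_two by blast
    obtain q where q: "q \<noteq> y" "q \<noteq> p" using point_avoiding_two by blast
    have "g n0 \<in> \<Gamma>" using g(1) by auto
    then have "p = q" using *[OF p] *[OF q(1)] by (metis iv_apply(2))
    then show False using q by simp
  qed
  obtain h x' y' where h: "inj (h :: nat \<Rightarrow> _)" "range h \<subseteq> range g"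
    and lh: "loc_unif_to_const euclidean (UNIV - {y'}) h x'"
    and l: "\<forall>\<eta>\<in>\<Gamma>. (\<lambda>j. d (Inl (h j \<circ> \<eta>)) (Inr x')) \<longlonglongrightarrow> 0"
    and "(\<lambda>j. d (Inl (iv (h j))) (Inr y')) \<longlonglongrightarrow> 0"
    by (rule convergence_sequence_in[OF inf g(1)])
  \<comment> \<open>Away from both repelling points the limits belonging to \<open>g\<close> and to
    \<open>h\<close> can be compared at a single point.\<close>
  obtain p where p: "p \<noteq> y" "p \<noteq> y'" using point_avoiding_two by blast
  have "(\<lambda>n. h n p) \<longlonglongrightarrow> x'"
    by (rule loc_unif_to_const_pointwise[OF lh]) (use p in simp)
  \<comment> \<open>\<open>h\<close> need not be a subsequence of \<open>g\<close>, but it takes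
    values of \<open>g\<close> injectively, so only finitely many \<open>h n\<close> are among the
    finitely many exceptional values.\<close>
  moreover have "(\<lambda>n. h n p) \<longlonglongrightarrow> x"
  proof (rule topological_tendstoI)
    fix U assume U: "open U" "x \<in> U"
    have "(\<lambda>n. g n p) \<longlonglongrightarrow> x"
      by (rule loc_unif_to_const_pointwise[OF g(2)]) (use p in simp)
    then have "\<forall>\<^sub>F n in sequentially. g n p \<in> U"
      using U by (rule topological_tendstoD)
    then have "finite {n. g n p \<notin> U}"
      unfolding cofinite_eq_sequentially[symmetric] eventually_cofinite .
    then have "finite (g ` {n. g n p \<notin> U})" by simp
    then have "finite (h -` (g ` {n. g n p \<notin> U}))" using h(1) by (rule finite_vimageI)
    moreover have "{n. h n p \<notin> U} \<subseteq> h -` (g ` {n. g n p \<notin> U})"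
    proof
      fix n assume n: "n \<in> {n. h n p \<notin> U}"
      obtain k where "h n = g k" using h(2) by blast
      then show "n \<in> h -` (g ` {n. g n p \<notin> U})" using n by auto
    qed
    ultimately have "finite {n. h n p \<notin> U}" by (rule finite_subset[rotated])
    then show "\<forall>\<^sub>F n in sequentially. h n p \<in> U"
      unfolding cofinite_eq_sequentially[symmetric] eventually_cofinite .
  qed
  ultimately have "x' = x" by (rule LIMSEQ_unique)
  show "x \<in> ?R"
  proof (intro CollectI allI impI)
    fix e :: real assume "0 < e"
    then have "\<forall>\<^sub>F j in sequentially. d (Inl (h j \<circ> id)) (Inr x') < e"
      using l[rule_format, OF id_mem] by (auto dest: order_tendstoD)
    then obtain j where "d (Inl (h j)) (Inr x') < e" by (auto simp: eventually_sequentially)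
    moreover have "h j \<in> \<Gamma>" using h(2) g(1) by blast
    ultimately show "\<exists>g\<in>\<Gamma>. d (Inl g) (Inr x) < e" using \<open>x' = x\<close> by blast
  qed
next
  fix x assume x: "x \<in> ?R"
  have "\<forall>n. \<exists>g\<in>\<Gamma>. d (Inl g) (Inr x) < 1 / real (Suc n)" using x by simp
  then obtain g where g: "\<And>n. g n \<in> \<Gamma>" "\<And>n. d (Inl (g n)) (Inr x) < 1 / real (Suc n)" by metis
  have lim: "(\<lambda>n. d (Inl (g n)) (Inr x)) \<longlonglongrightarrow> 0"
  proof (rule tendsto_sandwich[OF _ _ tendsto_const LIMSEQ_inverse_real_of_nat])
    show "\<forall>\<^sub>F n in sequentially. d (Inl (g n)) (Inr x) \<le> inverse (real (Suc n))"
      using g(2) by (auto intro!: always_eventually less_imp_le simp: inverse_eq_divide simp del: of_nat_Suc)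
  qed auto
  have cof: "finite {n. d (Inl (g n)) (Inr x) \<ge> e}" if "e > 0" for e
  proof -
    have "\<forall>\<^sub>F n in sequentially. d (Inl (g n)) (Inr x) < e"
      using lim that by (auto dest: order_tendstoD)
    then show ?thesis
      unfolding cofinite_eq_sequentially[symmetric] eventually_cofinite by (simp add: not_less)
  qed
  \<comment> \<open>A group element has positive distance from \<open>Inr x\<close>, so no value
    occurs infinitely often in a sequence approaching \<open>Inr x\<close>.\<close>
  have inf: "infinite (range g)"
  proof
    assume "finite (range g)"
    then obtain n0 where n0: "infinite {n. g n = g n0}"
      using pigeonhole_infinite[of UNIV g] by auto
    have "d (Inl (g n0)) (Inr x) > 0" using g(1) by simp
    from cof[OF this] have "finite {n. g n = g n0}" by (rule finite_subset[rotated]) auto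
    then show False using n0 by simp
  qed
  obtain h x' y' where h: "inj (h :: nat \<Rightarrow> _)" "range h \<subseteq> range g"
    and lh: "loc_unif_to_const euclidean (UNIV - {y'}) h x'"
    and l: "\<forall>\<eta>\<in>\<Gamma>. (\<lambda>j. d (Inl (h j \<circ> \<eta>)) (Inr x')) \<longlonglongrightarrow> 0"
    and "(\<lambda>j. d (Inl (iv (h j))) (Inr y')) \<longlonglongrightarrow> 0"
    by (rule convergence_sequence_in[OF inf]) (use g(1) in auto)
  have hm: "h j \<in> \<Gamma>" for j
  proof -
    obtain k where "h j = g k" using h(2) by blast
    then show ?thesis using g(1) by simp
  qed
  have "x' = x"
  proof (rule ccontr)
    assume "x' \<noteq> x"
    then have pos: "d (Inr x') (Inr x) > 0" by simp
    define e where "e = d (Inr x') (Inr x) / 2"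
    have e: "e > 0" using pos by (simp add: e_def)
    have "finite {n. d (Inl (h n)) (Inr x) \<ge> e}"
    proof (rule finite_subset)
      show "finite (h -` (g ` {n. d (Inl (g n)) (Inr x) \<ge> e}))"
        using cof[OF e] h(1) by (intro finite_vimageI) auto
      show "{n. d (Inl (h n)) (Inr x) \<ge> e} \<subseteq> h -` (g ` {n. d (Inl (g n)) (Inr x) \<ge> e})"
      proof
        fix n assume n: "n \<in> {n. d (Inl (h n)) (Inr x) \<ge> e}"
        obtain k where "h n = g k" using h(2) by blast
        then show "n \<in> h -` (g ` {n. d (Inl (g n)) (Inr x) \<ge> e})" using n by auto
      qed
    qed
    then have "\<forall>\<^sub>F n in sequentially. d (Inl (h n)) (Inr x) < e"
      unfolding cofinite_eq_sequentially[symmetric] eventually_cofinite by (simp add: not_less)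
    moreover have "\<forall>\<^sub>F n in sequentially. d (Inl (h n \<circ> id)) (Inr x') < e"
      using l[rule_format, OF id_mem] e by (auto dest: order_tendstoD)
    ultimately have "\<forall>\<^sub>F n in sequentially. False"
    proof eventually_elim
      case (elim n)
      have "d (Inr x') (Inr x) \<le> d (Inr x') (Inl (h n)) + d (Inl (h n)) (Inr x)"
        by (rule triangle) (use hm in auto)
      then show ?case using elim by (simp add: e_def commute)
    qed
    then show False by simp
  qed
  then show "x \<in> limit_set \<Gamma>"
    unfolding limit_set_def using lh hm by blast
qed

text \<open>By \<open>limit_set_eq\<close> the limit set is the trace on M of the closure of
  \<open>\<Gamma>\<close> in the compactification.\<close>

lemma closed_limit_set: "closed (limit_set \<Gamma>)"
proof -
  have "- limit_set \<Gamma> = {p. Inr p \<in> (\<Gamma> <+> UNIV) - mtopology closure_of (Inl ` \<Gamma>)}"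
    unfolding limit_set_eq metric_closure_of by (auto simp: commute)
  moreover have "openin mtopology ((\<Gamma> <+> UNIV) - mtopology closure_of (Inl ` \<Gamma>))"
    by (intro openin_diff) auto
  ultimately have "open (- limit_set \<Gamma>)" using open_Inr_vimage by metis
  then show ?thesis by (simp add: closed_def)
qed

text \<open>Among three points at mutual distance at least \<open>5 * \<epsilon>\<close>, at most
  one lies within \<open>2 * \<epsilon>\<close> of a given group element, so two elements leave one
  point free. Two elements are treated at once because \<open>magnitude_translate\<close> needs one
  base point for both \<open>g\<close> and \<open>b \<circ> g\<close>.\<close>

lemma far_points:
  "\<exists>P \<epsilon>. finite (P :: 'm set) \<and> 0 < \<epsilon> \<and> (\<forall>g\<in>\<Gamma>. \<forall>h\<in>\<Gamma>.
    \<exists>p\<in>P. d (Inr p) (Inl g) > 2 * \<epsilon> \<and> d (Inr p) (Inl h) > 2 * \<epsilon>)"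
proof -
  obtain P :: "'m set" where P: "finite P" "card P = 3" using three_points by blast
  define D where "D = (\<lambda>(p, q). d (Inr p) (Inr q)) ` {(p, q) \<in> P \<times> P. p \<noteq> q}"
  have "finite {(p, q) \<in> P \<times> P. p \<noteq> q}"
    by (rule finite_subset[of _ "P \<times> P"]) (use P(1) in auto)
  then have finD: "finite D" unfolding D_def by simp
  \<comment> \<open>A fifth, because the triangle inequality produces \<open>4 * \<epsilon>\<close>,
    which must stay below the separation. The entry 1 ensures a minimum over a nonempty set.\<close>
  define \<epsilon> where "\<epsilon> = Min (insert 1 D) / 5"
  have pos: "0 < Min (insert 1 D)" using finD by (auto simp: D_def)
  have sep: "5 * \<epsilon> \<le> d (Inr p) (Inr q)" if "p \<in> P" "q \<in> P" "p \<noteq> q" for p q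
  proof -
    have "d (Inr p) (Inr q) \<in> D" unfolding D_def using that by force
    then show ?thesis unfolding \<epsilon>_def using finD by simp
  qed
  have near: "card {p\<in>P. d (Inr p) (Inl g) \<le> 2 * \<epsilon>} \<le> 1" if g: "g \<in> \<Gamma>" for g
  proof (rule card_le_Suc0_iff_eq[THEN iffD2, folded One_nat_def])
    show "finite {p\<in>P. d (Inr p) (Inl g) \<le> 2 * \<epsilon>}" using P(1) by simp
    show "\<forall>p\<in>{p\<in>P. d (Inr p) (Inl g) \<le> 2 * \<epsilon>}. \<forall>q\<in>{p\<in>P. d (Inr p) (Inl g) \<le> 2 * \<epsilon>}. p = q"
    proof (intro ballI)
      fix p q assume pq: "p \<in> {p\<in>P. d (Inr p) (Inl g) \<le> 2 * \<epsilon>}" "q \<in> {p\<in>P. d (Inr p) (Inl g) \<le> 2 * \<epsilon>}"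
      have "d (Inr p) (Inr q) \<le> d (Inr p) (Inl g) + d (Inl g) (Inr q)"
        by (rule triangle) (use g in auto)
      also have "\<dots> \<le> 4 * \<epsilon>" using pq by (simp add: commute)
      finally show "p = q" using sep[of p q] pq pos by (cases "p = q") (auto simp: \<epsilon>_def)
    qed
  qed
  have "\<exists>p\<in>P. d (Inr p) (Inl g) > 2 * \<epsilon> \<and> d (Inr p) (Inl h) > 2 * \<epsilon>" if "g \<in> \<Gamma>" "h \<in> \<Gamma>" for g h
  proof (rule ccontr)
    let ?N = "\<lambda>g. {p\<in>P. d (Inr p) (Inl g) \<le> 2 * \<epsilon>}"
    assume "\<not> ?thesis"
    then have "P \<subseteq> ?N g \<union> ?N h" by (auto simp: not_less)
    then have "card P \<le> card (?N g \<union> ?N h)" using P(1) by (intro card_mono) auto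
    also have "\<dots> \<le> card (?N g) + card (?N h)" by (rule card_Un_le)
    also have "\<dots> \<le> 1 + 1" by (intro add_mono near that)
    finally show False using P(2) by simp
  qed
  then show ?thesis using P(1) pos by (intro exI[of _ P] exI[of _ \<epsilon>]) (auto simp: \<epsilon>_def)
qed

end

section \<open>Weights at the critical exponent\<close>

lemma summable_on_nonneg_comparison:
  fixes f g :: "'a \<Rightarrow> real"
  assumes "g summable_on A" "\<And>x. x \<in> A \<Longrightarrow> 0 \<le> f x" "\<And>x. x \<in> A \<Longrightarrow> f x \<le> g x"
  shows "f summable_on A"
proof (rule summable_on_comparison_test[OF assms(1)])
qed (use assms in auto)

lemma infsum_finite_sum:
  fixes f :: "'p \<Rightarrow> 'a \<Rightarrow> real"
  assumes "finite P" "\<And>p. p \<in> P \<Longrightarrow> f p summable_on A"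
  shows "(\<lambda>x. \<Sum>p\<in>P. f p x) summable_on A" "infsum (\<lambda>x. \<Sum>p\<in>P. f p x) A = (\<Sum>p\<in>P. infsum (f p) A)"
  using assms by (induction P rule: finite_induct) (simp_all add: summable_on_add infsum_add)

lemma critical_exponent_nonneg:
  assumes "critical_exponent G mag = ereal \<delta>" shows "0 \<le> \<delta>"
proof -
  have "0 \<le> critical_exponent G mag"
    unfolding critical_exponent_def by (rule Inf_greatest) auto
  then show ?thesis using assms by simp
qed

text \<open>Some series with exponent \<open>s > 0\<close> converges, and its terms are bounded
  below by \<open>exp (- s * u)\<close> on the sublevel set.\<close>

lemma finite_sublevel_of_critical_exponent:
  assumes "critical_exponent G mag = ereal \<delta>"
  shows "finite {g\<in>G. mag g \<le> u}"
proof -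
  have "critical_exponent G mag < \<infinity>" using assms by simp
  then obtain s where s: "s > 0" "(\<lambda>g. exp (- s * mag g)) summable_on G"
    unfolding critical_exponent_def Inf_less_iff by auto
  have "(\<lambda>g. exp (- s * u)) summable_on {g\<in>G. mag g \<le> u}"
  proof (rule summable_on_nonneg_comparison)
    show "(\<lambda>g. exp (- s * mag g)) summable_on {g\<in>G. mag g \<le> u}"
      using s(2) by (rule summable_on_subset_banach) auto
  qed (use s(1) in auto)
  then show ?thesis using infsum_diverge_constant[of "{g\<in>G. mag g \<le> u}" "exp (- s * u)"] by fastforce
qed

text \<open>Monotonicity in the exponent fails for negative magnitudes; the elements with
  \<open>mag g \<le> 0\<close> are finitely many and are split off.\<close>

lemma summable_above_critical_exponent:
  assumes crit: "critical_exponent G mag = ereal \<delta>" and t: "\<delta> < t"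
  shows "(\<lambda>g. exp (- t * mag g)) summable_on G"
proof -
  have "critical_exponent G mag < ereal t" using assms by simp
  then obtain s where s: "s > 0" "s < t" "(\<lambda>g. exp (- s * mag g)) summable_on G"
    unfolding critical_exponent_def Inf_less_iff by auto
  let ?F = "{g\<in>G. mag g \<le> 0}"
  have fin: "finite ?F" by (rule finite_sublevel_of_critical_exponent[OF crit])
  have "(\<lambda>g. exp (- t * mag g)) summable_on (G - ?F)"
  proof (rule summable_on_nonneg_comparison)
    show "(\<lambda>g. exp (- s * mag g)) summable_on (G - ?F)"
      using s(3) by (rule summable_on_subset_banach) auto
  qed (use s in \<open>auto simp: mult_right_mono\<close>)
  moreover have "(\<lambda>g. exp (- t * mag g)) summable_on ?F" using fin by (rule summable_on_finite)
  ultimately have "(\<lambda>g. exp (- t * mag g)) summable_on ((G - ?F) \<union> ?F)"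
    by (rule summable_on_Un_disjoint) auto
  moreover have "(G - ?F) \<union> ?F = G" by auto
  ultimately show ?thesis by simp
qed

text \<open>For \<open>t > 0\<close> this is the infimum property. The infimum ranges over positive
  exponents, so \<open>t \<le> 0\<close> is treated apart: the terms are then at least 1 at all
  elements of positive magnitude, of which there are infinitely many.\<close>

lemma not_summable_below_critical_exponent:
  assumes crit: "critical_exponent G mag = ereal \<delta>" and t: "t < \<delta>" and inf: "infinite G"
  shows "\<not> (\<lambda>g. exp (- t * mag g)) summable_on G"
proof
  assume sum: "(\<lambda>g. exp (- t * mag g)) summable_on G"
  show False
  proof (cases "t > 0")
    case True
    then have "critical_exponent G mag \<le> ereal t"
      unfolding critical_exponent_def using sum by (intro Inf_lower) auto
    then show False using crit t by simp
  next
    case False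
    let ?F = "{g\<in>G. mag g \<le> 0}"
    have "(\<lambda>g. 1::real) summable_on (G - ?F)"
    proof (rule summable_on_nonneg_comparison)
      show "(\<lambda>g. exp (- t * mag g)) summable_on (G - ?F)"
        using sum by (rule summable_on_subset_banach) auto
    qed (use False in \<open>auto simp: mult_nonpos_nonneg\<close>)
    then have "finite (G - ?F)" using infsum_diverge_constant[of "G - ?F" "1::real"] by fastforce
    then show False
      using finite_sublevel_of_critical_exponent[OF crit, of 0] inf by simp
  qed
qed

text \<open>Patterson's device: the series need not diverge at \<open>\<delta>\<close>, so it is multiplied by slowly varying
  weights which keep it convergent while its sum tends to infinity. Below \<open>b n\<close> grows like
  \<open>exp (u / Suc n)\<close> up to a threshold and decays like \<open>exp (- u / Suc n)\<close> beyond it.\<close>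

lemma slowly_varying_weights:
  fixes G :: "'g set"
  assumes crit: "critical_exponent G mag = ereal \<delta>" and inf: "infinite G"
  shows "\<exists>b :: nat \<Rightarrow> real \<Rightarrow> real.
    (\<forall>n u. 0 < b n u) \<and>
    (\<forall>n u v. b n u \<le> exp (\<bar>u - v\<bar> / Suc n) * b n v) \<and>
    (\<forall>n u. b n u \<le> exp \<bar>u\<bar>) \<and>
    (\<forall>n. (\<lambda>g. exp (- \<delta> * mag g) * b n (mag g)) summable_on G) \<and>
    (\<forall>n. real n \<le> (\<Sum>\<^sub>\<infinity>g\<in>G. exp (- \<delta> * mag g) * b n (mag g)))"
proof -
  \<comment> \<open>The exponent is a tent with slopes \<open>1 / Suc n\<close> and
    \<open>- 1 / Suc n\<close>, meeting at \<open>u = R * Suc n / 2\<close>; hence it is Lipschitz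
    with constant \<open>1 / Suc n\<close>.\<close>
  define B :: "nat \<Rightarrow> real \<Rightarrow> real \<Rightarrow> real" where "B n R u = exp (min (u / Suc n) (R - u / Suc n))" for n R u
  have pos: "0 < B n R u" for n R u by (simp add: B_def)
  have slow: "B n R u \<le> exp (\<bar>u - v\<bar> / Suc n) * B n R v" for n R u v
  proof -
    have "(u - v) / Suc n \<le> \<bar>u - v\<bar> / Suc n" "(v - u) / Suc n \<le> \<bar>u - v\<bar> / Suc n"
      by (intro divide_right_mono; simp)+
    then have "min (u / Suc n) (R - u / Suc n) \<le> \<bar>u - v\<bar> / Suc n + min (v / Suc n) (R - v / Suc n)"
      unfolding diff_divide_distrib by linarith
    then show ?thesis by (simp add: B_def exp_add[symmetric])
  qed
  have bnd: "B n R u \<le> exp \<bar>u\<bar>" for n R u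
  proof -
    have "u / Suc n \<le> \<bar>u\<bar> / 1"
      by (intro frac_le) auto
    then show ?thesis by (simp add: B_def min_le_iff_disj)
  qed
  \<comment> \<open>Bounding the minimum by its decreasing branch compares the series with the one
    at exponent \<open>\<delta> + 1 / Suc n\<close>, which converges.\<close>
  have summ: "(\<lambda>g. exp (- \<delta> * mag g) * B n R (mag g)) summable_on G" for n R
  proof (rule summable_on_nonneg_comparison)
    have "(\<lambda>g. exp (- (\<delta> + 1 / Suc n) * mag g)) summable_on G"
      by (rule summable_above_critical_exponent[OF crit]) simp
    then show "(\<lambda>g. exp R * exp (- (\<delta> + 1 / Suc n) * mag g)) summable_on G"
      by (rule summable_on_cmult_right)
    show "exp (- \<delta> * mag g) * B n R (mag g) \<le> exp R * exp (- (\<delta> + 1 / Suc n) * mag g)" for g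
    proof -
      have "min (mag g / Suc n) (R - mag g / Suc n) \<le> R - mag g / Suc n" by simp
      moreover have "- (\<delta> + 1 / Suc n) * mag g = - \<delta> * mag g - mag g / Suc n"
        by (simp add: algebra_simps del: of_nat_Suc)
      ultimately have "- \<delta> * mag g + min (mag g / Suc n) (R - mag g / Suc n)
        \<le> R + (- (\<delta> + 1 / Suc n) * mag g)" by linarith
      then show ?thesis unfolding B_def exp_add[symmetric] by simp
    qed
    show "0 \<le> exp (- \<delta> * mag g) * B n R (mag g)" for g
      using pos by (simp add: less_imp_le)
  qed
  \<comment> \<open>Slightly below \<open>\<delta>\<close> the series diverges, so a finite part
    \<open>F\<close> exceeds \<open>n\<close>. For \<open>R\<close> large, \<open>F\<close> lies on
    the growing branch, where the weight turns the exponent \<open>\<delta>\<close> into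
    \<open>?t\<close>.\<close>
  have "\<exists>R. real n \<le> (\<Sum>\<^sub>\<infinity>g\<in>G. exp (- \<delta> * mag g) * B n R (mag g))" for n
  proof -
    let ?t = "\<delta> - 1 / Suc n"
    have "\<not> (\<lambda>g. exp (- ?t * mag g)) summable_on G"
      by (rule not_summable_below_critical_exponent[OF crit _ inf]) simp
    then have "\<not> bdd_above (sum (\<lambda>g. exp (- ?t * mag g)) ` {F. F \<subseteq> G \<and> finite F})"
      using nonneg_bdd_above_summable_on[of G "\<lambda>g. exp (- ?t * mag g)"] by auto
    then obtain F where F: "F \<subseteq> G" "finite F" "real n < (\<Sum>g\<in>F. exp (- ?t * mag g))"
      unfolding bdd_above_def by (auto simp: not_le)
    define R where "R = Max (insert 0 ((\<lambda>g. 2 * mag g / Suc n) ` F))"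
    have R: "2 * mag g / Suc n \<le> R" if "g \<in> F" for g
      unfolding R_def using F(2) that by (intro Max_ge) auto
    have "(\<Sum>g\<in>F. exp (- ?t * mag g)) = (\<Sum>g\<in>F. exp (- \<delta> * mag g) * B n R (mag g))"
    proof (rule sum.cong[OF refl])
      fix g assume "g \<in> F"
      from R[OF this] have "mag g / Suc n \<le> R - mag g / Suc n" by linarith
      then have "min (mag g / Suc n) (R - mag g / Suc n) = mag g / Suc n" by simp
      then show "exp (- ?t * mag g) = exp (- \<delta> * mag g) * B n R (mag g)"
        by (simp add: B_def exp_add[symmetric] algebra_simps)
    qed
    also have "\<dots> \<le> (\<Sum>\<^sub>\<infinity>g\<in>G. exp (- \<delta> * mag g) * B n R (mag g))"
      by (rule finite_sum_le_infsum[OF summ F(2,1)]) (simp add: pos less_imp_le)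
    finally show ?thesis using F(3) by (intro exI[of _ R]) simp
  qed
  then obtain R where R: "\<And>n. real n \<le> (\<Sum>\<^sub>\<infinity>g\<in>G. exp (- \<delta> * mag g) * B n (R n) (mag g))"
    by metis
  show ?thesis
    by (rule exI[of _ "\<lambda>n. B n (R n)"]) (use pos slow bnd summ R in auto)
qed

text \<open>Off the finite set where \<open>E g \<ge> e/2\<close> the sum is at most
  \<open>e/2\<close> times the total. On that set the bound \<open>K\<close> keeps the contribution
  below a constant independent of \<open>n\<close>, negligible against a total of at least
  \<open>n\<close>.\<close>

lemma weighted_average_of_vanishing:
  fixes A :: "nat \<Rightarrow> 'g \<Rightarrow> real" and E :: "'g \<Rightarrow> real"
  assumes A_nonneg: "\<And>n g. g \<in> G \<Longrightarrow> 0 \<le> A n g"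
    and A_sum: "\<And>n. A n summable_on G"
    and A_bound: "\<And>n g. g \<in> G \<Longrightarrow> A n g \<le> K g"
    and A_div: "\<And>n. real n \<le> infsum (A n) G"
    and E_nonneg: "\<And>g. g \<in> G \<Longrightarrow> 0 \<le> E g"
    and E_bound: "\<And>g. g \<in> G \<Longrightarrow> E g \<le> D"
    and E_vanish: "\<And>e. 0 < e \<Longrightarrow> finite {g\<in>G. e \<le> E g}"
  shows "(\<lambda>g. E g * A n g) summable_on G"
    and "(\<lambda>n. infsum (\<lambda>g. E g * A n g) G / infsum (A n) G) \<longlonglongrightarrow> 0"
proof -
  show summ: "(\<lambda>g. E g * A n g) summable_on G" for n
  proof (rule summable_on_nonneg_comparison)
    show "(\<lambda>g. D * A n g) summable_on G" by (rule summable_on_cmult_right[OF A_sum])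
  qed (use E_nonneg A_nonneg E_bound in \<open>auto intro: mult_right_mono\<close>)
  let ?T = "\<lambda>n. infsum (A n) G"
  have nonneg: "0 \<le> infsum (\<lambda>g. E g * A n g) G" for n
    by (rule infsum_nonneg) (use E_nonneg A_nonneg in auto)
  show "(\<lambda>n. infsum (\<lambda>g. E g * A n g) G / ?T n) \<longlonglongrightarrow> 0"
  proof (rule tendstoI)
    fix e :: real assume e: "0 < e"
    define F where "F = {g\<in>G. e/2 \<le> E g}"
    have F: "finite F" "F \<subseteq> G" unfolding F_def using E_vanish[of "e/2"] e by auto
    have ind: "(\<lambda>g. if g \<in> F then E g * K g else 0) summable_on G"
    proof (rule summable_on_cong_neutral[THEN iffD1])
      show "(\<lambda>g. E g * K g) summable_on F" using F(1) by (rule summable_on_finite)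
    qed (use F in auto)
    define c where "c = (\<Sum>g\<in>F. E g * K g)"
    obtain n0 :: nat where "max 1 (2 * c / e) < real n0" using reals_Archimedean2 by blast
    then have n0: "2 * c / e < real n0" "0 < n0" by auto
    have "infsum (\<lambda>g. E g * A n g) G / ?T n < e" if n: "n \<ge> n0" for n
    proof -
      have T: "?T n \<ge> real n0" "?T n > 0" using A_div[of n] n n0(2) by linarith+
      have "infsum (\<lambda>g. E g * A n g) G \<le> infsum (\<lambda>g. e/2 * A n g + (if g \<in> F then E g * K g else 0)) G"
      proof (rule infsum_mono[OF summ])
        show "(\<lambda>g. e/2 * A n g + (if g \<in> F then E g * K g else 0)) summable_on G"
          by (intro summable_on_add summable_on_cmult_right A_sum ind)
        fix g assume g: "g \<in> G"
        show "E g * A n g \<le> e/2 * A n g + (if g \<in> F then E g * K g else 0)"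
        proof (cases "g \<in> F")
          case True
          have "E g * A n g \<le> E g * K g" using E_nonneg A_bound g by (intro mult_left_mono) auto
          moreover have "0 \<le> e/2 * A n g" using e A_nonneg[OF g] by simp
          ultimately show ?thesis using True by simp
        next
          case False
          then have "E g \<le> e/2" using g by (auto simp: F_def)
          from mult_right_mono[OF this A_nonneg[OF g, of n]] show ?thesis using False by simp
        qed
      qed
      also have "\<dots> = infsum (\<lambda>g. e/2 * A n g) G + infsum (\<lambda>g. if g \<in> F then E g * K g else 0) G"
        by (rule infsum_add[OF summable_on_cmult_right[OF A_sum] ind])

      also have "infsum (\<lambda>g. if g \<in> F then E g * K g else 0) G = infsum (\<lambda>g. E g * K g) F"
        by (rule infsum_cong_neutral) (use F in auto)
      also have "\<dots> = c" using F by (simp add: c_def)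
      also have "infsum (\<lambda>g. e/2 * A n g) G = e/2 * ?T n" by (rule infsum_cmult_right')
      finally have "infsum (\<lambda>g. E g * A n g) G \<le> e/2 * ?T n + c" .
      moreover have "c < e/2 * ?T n"
      proof -
        have "2 * c / e < ?T n" using n0(1) T(1) by linarith
        then show ?thesis using e by (simp add: field_simps)
      qed
      ultimately have "infsum (\<lambda>g. E g * A n g) G < e * ?T n" by (simp add: field_simps)
      then show ?thesis using T(2) by (simp add: divide_less_eq)
    qed
    moreover have "0 \<le> infsum (\<lambda>g. E g * A n g) G / ?T n" for n
      by (intro divide_nonneg_nonneg nonneg infsum_nonneg A_nonneg)
    ultimately show "\<forall>\<^sub>F n in sequentially. dist (infsum (\<lambda>g. E g * A n g) G / ?T n) 0 < e"
      unfolding eventually_sequentially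
      by (intro exI[of _ n0]) (auto simp only: dist_real_def diff_0_right abs_of_nonneg)
  qed
qed

section \<open>Orbit sums and their limits\<close>

text \<open>The base points \<open>P\<close> and the scale \<open>\<epsilon>\<close> are parameters
  so that the cutoff can refer to them; \<open>far_points\<close> supplies them.\<close>

locale coarse_cocycle_with_magnitude = compactified_convergence_group \<Gamma> d
  for \<Gamma> :: "('m::metric_space \<Rightarrow> 'm) set"
    and d :: "('m \<Rightarrow> 'm) + 'm \<Rightarrow> ('m \<Rightarrow> 'm) + 'm \<Rightarrow> real" +
  fixes \<sigma> :: "('m \<Rightarrow> 'm) \<Rightarrow> 'm \<Rightarrow> real"
    and mag :: "('m \<Rightarrow> 'm) \<Rightarrow> real"
    and \<kappa> \<delta> :: real
    and P :: "'m set" and \<epsilon> :: real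
  assumes cocycle: "coarse_cocycle \<kappa> \<Gamma> \<sigma>"
    and magnitude: "magnitude \<Gamma> d \<sigma> mag"
    and crit: "critical_exponent \<Gamma> mag = ereal \<delta>"
    and finite_P: "finite P"
    and eps_pos: "0 < \<epsilon>"
    and far_point: "\<And>g h. g \<in> \<Gamma> \<Longrightarrow> h \<in> \<Gamma> \<Longrightarrow>
      \<exists>p\<in>P. d (Inr p) (Inl g) > 2 * \<epsilon> \<and> d (Inr p) (Inl h) > 2 * \<epsilon>"
begin

section \<open>Bounds on the cocycle and the magnitude\<close>

lemma \<delta>_nonneg: "0 \<le> \<delta>"
  by (rule critical_exponent_nonneg[OF crit])

lemma cocycle_ineq:
  assumes "g \<in> \<Gamma>" "h \<in> \<Gamma>"
  shows "\<bar>\<sigma> (g \<circ> h) x - (\<sigma> g (h x) + \<sigma> h x)\<bar> \<le> \<kappa>"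
  using cocycle assms unfolding coarse_cocycle_def by blast

lemma cocycle_near:
  assumes "g \<in> \<Gamma>" "0 < e"
  shows "\<forall>\<^sub>F y in nhds x. \<bar>\<sigma> g x - \<sigma> g y\<bar> < \<kappa> + e"
proof -
  have \<kappa>: "0 \<le> \<kappa>" using cocycle by (simp add: coarse_cocycle_def)
  have "Limsup (at x) (\<lambda>y. ereal \<bar>\<sigma> g x - \<sigma> g y\<bar>) \<le> ereal \<kappa>"
    using cocycle assms(1) unfolding coarse_cocycle_def by blast
  also have "\<dots> < ereal (\<kappa> + e)" using assms(2) by simp
  finally have "\<forall>\<^sub>F y in at x. ereal \<bar>\<sigma> g x - \<sigma> g y\<bar> < ereal (\<kappa> + e)"
    by (rule Limsup_lessD)
  \<comment> \<open>\<open>at x\<close> omits the point \<open>x\<close> itself, where the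
    difference is 0 and \<open>0 < \<kappa> + e\<close> suffices.\<close>
  then show ?thesis
    unfolding eventually_at_filter
    by eventually_elim (use \<kappa> assms(2) in auto)
qed

text \<open>Each point has a neighbourhood on which the cocycle stays within
  \<open>\<kappa> + 1\<close> of its value at that point; finitely many of these cover M.\<close>

lemma cocycle_bounded:
  assumes "g \<in> \<Gamma>" shows "\<exists>B. \<forall>x. \<bar>\<sigma> g x\<bar> \<le> B"
proof -
  have "\<forall>x. \<exists>U. open U \<and> x \<in> U \<and> (\<forall>y\<in>U. \<bar>\<sigma> g x - \<sigma> g y\<bar> < \<kappa> + 1)"
    using cocycle_near[OF assms, of 1] by (simp add: eventually_nhds)
  then obtain U where U: "\<And>x. open (U x)" "\<And>x. x \<in> U x"
    "\<And>x y. y \<in> U x \<Longrightarrow> \<bar>\<sigma> g x - \<sigma> g y\<bar> < \<kappa> + 1" by metis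
  have "\<exists>C. finite C \<and> UNIV \<subseteq> (\<Union>c\<in>C. U c)"
    by (rule compactE_image[OF compact_M, of UNIV U]) (use U in auto)
  then obtain C where C: "finite C" "UNIV \<subseteq> (\<Union>c\<in>C. U c)" by blast
  show ?thesis
  proof (intro exI allI)
    fix x
    obtain c where c: "c \<in> C" "x \<in> U c" using C(2) by blast
    have "\<bar>\<sigma> g c\<bar> \<le> (\<Sum>c\<in>C. \<bar>\<sigma> g c\<bar>)" using c(1) C(1) by (intro member_le_sum) auto
    then show "\<bar>\<sigma> g x\<bar> \<le> \<kappa> + 1 + (\<Sum>c\<in>C. \<bar>\<sigma> g c\<bar>)" using U(3)[OF c(2)] by linarith
  qed
qed

lemma magnitude_bound:
  "\<exists>C>0. \<forall>g\<in>\<Gamma>. \<forall>p. d (Inr p) (Inl (iv g)) > \<epsilon> \<longrightarrow> \<bar>\<sigma> g p - mag g\<bar> \<le> C"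
proof -
  obtain C where C: "C > 0" "\<And>p g. g \<in> \<Gamma> \<Longrightarrow> d (Inr p) (Inl (iv g)) > \<epsilon> \<Longrightarrow>
    mag g - C \<le> \<sigma> g p \<and> \<sigma> g p \<le> mag g + C"
    using magnitude eps_pos unfolding magnitude_def by metis
  have "\<bar>\<sigma> g p - mag g\<bar> \<le> C" if "g \<in> \<Gamma>" "d (Inr p) (Inl (iv g)) > \<epsilon>" for g p
    using C(2)[OF that] by linarith
  then show ?thesis using C(1) by blast
qed

text \<open>At a base point far from the inverses of both \<open>g\<close> and
  \<open>b \<circ> g\<close>, the cocycle agrees with each magnitude up to \<open>C\<close>, and the
  two cocycle values differ by at most \<open>B + \<kappa>\<close>.\<close>

lemma magnitude_translate:
  assumes "b \<in> \<Gamma>"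
  shows "\<exists>D\<ge>0. \<forall>g\<in>\<Gamma>. \<bar>mag (b \<circ> g) - mag g\<bar> \<le> D"
proof -
  obtain C where C: "C > 0" "\<And>p g. g \<in> \<Gamma> \<Longrightarrow> d (Inr p) (Inl (iv g)) > \<epsilon> \<Longrightarrow> \<bar>\<sigma> g p - mag g\<bar> \<le> C"
    using magnitude_bound by blast
  obtain B where B: "\<And>x. \<bar>\<sigma> b x\<bar> \<le> B" using cocycle_bounded[OF assms] by blast
  have *: "\<bar>mag (b \<circ> g) - mag g\<bar> \<le> 2 * C + B + \<kappa>" if g: "g \<in> \<Gamma>" for g
  proof -
    obtain p where p: "d (Inr p) (Inl (iv g)) > 2 * \<epsilon>" "d (Inr p) (Inl (iv (b \<circ> g))) > 2 * \<epsilon>"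
      using far_point[of "iv g" "iv (b \<circ> g)"] g assms by auto
    have "\<bar>\<sigma> g p - mag g\<bar> \<le> C" "\<bar>\<sigma> (b \<circ> g) p - mag (b \<circ> g)\<bar> \<le> C"
      using p g assms eps_pos by (auto intro!: C(2))
    moreover have "\<bar>\<sigma> (b \<circ> g) p - (\<sigma> b (g p) + \<sigma> g p)\<bar> \<le> \<kappa>"
      by (rule cocycle_ineq[OF assms g])
    ultimately show ?thesis using B[of "g p"] by linarith
  qed
  moreover have "2 * C + B + \<kappa> \<ge> 0"
    using *[OF id_mem] by linarith
  ultimately show ?thesis by blast
qed

section \<open>Cutoff and orbit weights\<close>

definition cutoff :: "('m \<Rightarrow> 'm) \<Rightarrow> 'm \<Rightarrow> real" where
  "cutoff g p = max 0 (d (Inr p) (Inl (iv g)) - \<epsilon>)"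

lemma cutoff_nonneg: "0 \<le> cutoff g p"
  by (simp add: cutoff_def)

lemma cutoff_pos: "0 < cutoff g p \<Longrightarrow> d (Inr p) (Inl (iv g)) > \<epsilon>"
  by (simp add: cutoff_def max_def split: if_splits)

lemma d_bounded:
  "\<exists>D. \<forall>x y. x \<in> \<Gamma> <+> (UNIV :: 'm set) \<longrightarrow> y \<in> \<Gamma> <+> (UNIV :: 'm set) \<longrightarrow> d x y \<le> D"
proof -
  have "mbounded (\<Gamma> <+> UNIV)"
    using compactin_imp_mbounded compact_X unfolding compact_space_def by simp
  then show ?thesis unfolding mbounded_alt by blast
qed

lemma cutoff_bounded: "\<exists>D>0. \<forall>g\<in>\<Gamma>. \<forall>p. cutoff g p \<le> D"
proof -
  obtain D where D: "\<And>x y. x \<in> \<Gamma> <+> UNIV \<Longrightarrow> y \<in> \<Gamma> <+> UNIV \<Longrightarrow> d x y \<le> D"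
    using d_bounded by blast
  have "cutoff g p \<le> max 1 D" if "g \<in> \<Gamma>" for g p
    using D[of "Inr p" "Inl (iv g)"] that eps_pos by (simp add: cutoff_def max_def)
  then show ?thesis by (intro exI[of _ "max 1 D"]) auto
qed

text \<open>A truncated distance is 1-Lipschitz in the position of the inverse, which an indicator
  would not be. The bound is the displacement controlled by
  \<open>right_translation_displacement_finite\<close>.\<close>

lemma cutoff_translate:
  assumes "\<alpha> \<in> \<Gamma>" "h \<in> \<Gamma>"
  shows "\<bar>cutoff (iv \<alpha> \<circ> h) p - cutoff h p\<bar> \<le> d (Inl (iv h \<circ> \<alpha>)) (Inl (iv h))"
proof -
  have "\<bar>d (Inr p) (Inl (iv h \<circ> \<alpha>)) - d (Inr p) (Inl (iv h))\<bar> \<le> d (Inl (iv h \<circ> \<alpha>)) (Inl (iv h))"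
    using triangle[of "Inr p" "Inl (iv h \<circ> \<alpha>)" "Inl (iv h)"]
      triangle[of "Inr p" "Inl (iv h)" "Inl (iv h \<circ> \<alpha>)"] assms by (simp add: commute)
  moreover have "iv (iv \<alpha> \<circ> h) = iv h \<circ> \<alpha>" using assms by (simp add: iv_comp)
  ultimately show ?thesis by (simp add: cutoff_def)
qed

definition orbit_weight :: "(real \<Rightarrow> real) \<Rightarrow> ('m \<Rightarrow> 'm) \<Rightarrow> 'm \<Rightarrow> real" where
  "orbit_weight b g p = cutoff g p * exp (- \<delta> * \<sigma> g p) * b (mag g)"

text \<open>Where the cutoff is positive, \<open>\<sigma> g p\<close> is within \<open>C\<close> of
  \<open>mag g\<close>; where it vanishes, both sides are 0. Together with
  \<open>orbit_weight_ge\<close> this ties the orbit sums to the series of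
  \<open>slowly_varying_weights\<close>.\<close>

lemma orbit_weight_le:
  assumes C: "\<And>p g. g \<in> \<Gamma> \<Longrightarrow> d (Inr p) (Inl (iv g)) > \<epsilon> \<Longrightarrow> \<bar>\<sigma> g p - mag g\<bar> \<le> C"
    and b_pos: "\<And>u. 0 < b u" and g: "g \<in> \<Gamma>"
  shows "orbit_weight b g p \<le> cutoff g p * (exp (\<delta> * C) * (exp (- \<delta> * mag g) * b (mag g)))"
proof (cases "cutoff g p = 0")
  case False
  then have "cutoff g p > 0" using cutoff_nonneg[of g p] by simp
  then have "\<bar>\<sigma> g p - mag g\<bar> \<le> C" by (intro C g cutoff_pos)
  then have "\<delta> * (mag g - \<sigma> g p) \<le> \<delta> * C" using \<delta>_nonneg by (intro mult_left_mono) auto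
  then have "exp (- \<delta> * \<sigma> g p) \<le> exp (\<delta> * C) * exp (- \<delta> * mag g)"
    by (simp add: exp_add[symmetric] algebra_simps)
  then have "cutoff g p * exp (- \<delta> * \<sigma> g p) * b (mag g)
    \<le> cutoff g p * (exp (\<delta> * C) * exp (- \<delta> * mag g)) * b (mag g)"
    using b_pos cutoff_nonneg by (intro mult_right_mono mult_left_mono) (auto simp: less_imp_le)
  then show ?thesis by (simp add: orbit_weight_def mult.assoc)
qed (simp add: orbit_weight_def)

lemma orbit_weight_ge:
  assumes C: "\<And>p g. g \<in> \<Gamma> \<Longrightarrow> d (Inr p) (Inl (iv g)) > \<epsilon> \<Longrightarrow> \<bar>\<sigma> g p - mag g\<bar> \<le> C"
    and b_pos: "\<And>u. 0 < b u" and g: "g \<in> \<Gamma>"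
  shows "cutoff g p * (exp (- \<delta> * C) * (exp (- \<delta> * mag g) * b (mag g))) \<le> orbit_weight b g p"
proof (cases "cutoff g p = 0")
  case False
  then have "cutoff g p > 0" using cutoff_nonneg[of g p] by simp
  then have "\<bar>\<sigma> g p - mag g\<bar> \<le> C" by (intro C g cutoff_pos)
  then have "\<delta> * (\<sigma> g p - mag g) \<le> \<delta> * C" using \<delta>_nonneg by (intro mult_left_mono) auto
  then have "exp (- \<delta> * C) * exp (- \<delta> * mag g) \<le> exp (- \<delta> * \<sigma> g p)"
    by (simp add: exp_add[symmetric] algebra_simps)
  then have "cutoff g p * (exp (- \<delta> * C) * exp (- \<delta> * mag g)) * b (mag g)
    \<le> cutoff g p * exp (- \<delta> * \<sigma> g p) * b (mag g)"
    using b_pos cutoff_nonneg by (intro mult_right_mono mult_left_mono) (auto simp: less_imp_le)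
  then show ?thesis by (simp add: orbit_weight_def mult.assoc)
qed (simp add: orbit_weight_def)

text \<open>The three factors of the weight are exchanged separately. The cocycle and slow variation
  contribute multiplicative factors, whereas a change of cutoff, which may start from 0, is only an
  additive error.\<close>

lemma orbit_weight_compare:
  assumes C: "\<And>p g. g \<in> \<Gamma> \<Longrightarrow> d (Inr p) (Inl (iv g)) > \<epsilon> \<Longrightarrow> \<bar>\<sigma> g p - mag g\<bar> \<le> C"
    and b_pos: "\<And>u. 0 < b u" and g: "g \<in> \<Gamma>"
    and slow: "\<And>u v. b u \<le> exp (\<bar>u - v\<bar> / real (Suc n)) * b v"
    and D: "\<bar>mag g - mag g'\<bar> \<le> D"
    and E: "\<bar>cutoff g p - cutoff g' p\<bar> \<le> E"
    and k: "exp (- \<delta> * \<sigma> g p) \<le> k * exp (- \<delta> * \<sigma> g' p)"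
  shows "orbit_weight b g p \<le> exp (D / real (Suc n)) * k * orbit_weight b g' p
    + E * (exp (\<delta> * C) * (exp (- \<delta> * mag g) * b (mag g)))"
proof (cases "cutoff g p = 0")
  case True
  have "0 < k * exp (- \<delta> * \<sigma> g' p)" using k by (rule less_le_trans[rotated]) simp
  then have "0 < k" by (simp add: zero_less_mult_iff)
  moreover have "0 \<le> E" using E by linarith
  ultimately show ?thesis
    using b_pos cutoff_nonneg[of g' p]
    by (simp add: True orbit_weight_def less_imp_le)
next
  case False
  then have "cutoff g p > 0" using cutoff_nonneg[of g p] by simp
  then have "\<bar>\<sigma> g p - mag g\<bar> \<le> C" by (intro C g cutoff_pos)
  then have "\<delta> * (mag g - \<sigma> g p) \<le> \<delta> * C" using \<delta>_nonneg by (intro mult_left_mono) auto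
  then have e: "exp (- \<delta> * \<sigma> g p) \<le> exp (\<delta> * C) * exp (- \<delta> * mag g)"
    by (simp add: exp_add[symmetric] algebra_simps)
  have "0 < k * exp (- \<delta> * \<sigma> g' p)" using k by (rule less_le_trans[rotated]) simp
  then have k0: "0 < k" by (simp add: zero_less_mult_iff)
  have E0: "0 \<le> E" using E by linarith
  have bD: "b (mag g) \<le> exp (D / real (Suc n)) * b (mag g')"
  proof -
    have "b (mag g) \<le> exp (\<bar>mag g - mag g'\<bar> / real (Suc n)) * b (mag g')" by (rule slow)
    also have "\<dots> \<le> exp (D / real (Suc n)) * b (mag g')"
      using D b_pos by (intro mult_right_mono) (auto simp: divide_right_mono less_imp_le)
    finally show ?thesis .
  qed
  let ?w = "exp (- \<delta> * \<sigma> g p) * b (mag g)"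
  have w0: "0 \<le> ?w" using b_pos by (simp add: less_imp_le)
  have "orbit_weight b g p = cutoff g p * ?w" by (simp add: orbit_weight_def mult.assoc)
  also have "\<dots> \<le> (cutoff g' p + E) * ?w"
    using E w0 by (intro mult_right_mono) auto
  also have "\<dots> = cutoff g' p * ?w + E * ?w" by (rule distrib_right)
  \<comment> \<open>The main term uses the precise factor \<open>k\<close>; the error term uses the
    crude bound by the magnitude, so that it becomes a multiple of a term of the weighted
    series.\<close>
  also have "\<dots> \<le> cutoff g' p * ((k * exp (- \<delta> * \<sigma> g' p)) * (exp (D / real (Suc n)) * b (mag g')))
      + E * ((exp (\<delta> * C) * exp (- \<delta> * mag g)) * b (mag g))"
    using k0 E0 k bD e b_pos cutoff_nonneg
    by (intro add_mono mult_left_mono mult_mono mult_right_mono) (auto simp: less_imp_le)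
  also have "\<dots> = exp (D / real (Suc n)) * k * orbit_weight b g' p
    + E * (exp (\<delta> * C) * (exp (- \<delta> * mag g) * b (mag g)))"
    by (simp add: orbit_weight_def algebra_simps)
  finally show ?thesis .
qed

text \<open>A positive cutoff keeps the inverses away from \<open>p\<close>, so \<open>p\<close> is
  not the repelling point of a convergent sequence of such elements. The images of \<open>p\<close>
  then converge to a limit point, which would lie in the closed set \<open>K\<close>.\<close>

lemma finite_visits_off_limit_set:
  assumes K: "compact K" "K \<inter> limit_set \<Gamma> = {}"
  shows "finite {h\<in>\<Gamma>. h p \<in> K \<and> 0 < cutoff h p}"
proof (rule ccontr)
  assume inf: "infinite {h\<in>\<Gamma>. h p \<in> K \<and> 0 < cutoff h p}"
  obtain g x y where "inj (g :: nat \<Rightarrow> _)" and ran: "range g \<subseteq> {h\<in>\<Gamma>. h p \<in> K \<and> 0 < cutoff h p}"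
    and lu: "loc_unif_to_const euclidean (UNIV - {y}) g x"
    and l: "\<forall>\<eta>\<in>\<Gamma>. (\<lambda>j. d (Inl (g j \<circ> \<eta>)) (Inr x)) \<longlonglongrightarrow> 0"
    and li: "(\<lambda>j. d (Inl (iv (g j))) (Inr y)) \<longlonglongrightarrow> 0"
    by (rule convergence_sequence_in[OF inf]) auto
  have g: "g j \<in> \<Gamma>" "g j p \<in> K" "0 < cutoff (g j) p" for j
    using range_subsetD[OF ran, of j] by auto
  have "p \<noteq> y"
  proof
    assume "p = y"
    have "\<forall>\<^sub>F j in sequentially. d (Inl (iv (g j))) (Inr y) < \<epsilon>"
      using li eps_pos by (auto dest: order_tendstoD)
    then obtain j where "d (Inl (iv (g j))) (Inr y) < \<epsilon>" by (auto simp: eventually_sequentially)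
    then show False using cutoff_pos[OF g(3)[of j]] \<open>p = y\<close> by (simp add: commute)
  qed
  then have "(\<lambda>j. g j p) \<longlonglongrightarrow> x"
    by (intro loc_unif_to_const_pointwise[OF lu]) simp
  then have "x \<in> K"
    using closed_sequentially[OF compact_imp_closed[OF K(1)], of "\<lambda>j. g j p"] g(2) by simp
  moreover have "x \<in> limit_set \<Gamma>"
    unfolding limit_set_eq
  proof (intro CollectI allI impI)
    fix e :: real assume "0 < e"
    then have "\<forall>\<^sub>F j in sequentially. d (Inl (g j \<circ> id)) (Inr x) < e"
      using l[rule_format, OF id_mem] by (auto dest: order_tendstoD)
    then obtain j where "d (Inl (g j)) (Inr x) < e" by (auto simp: eventually_sequentially)
    then show "\<exists>g\<in>\<Gamma>. d (Inl g) (Inr x) < e" using g(1) by blast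
  qed
  ultimately show False using K(2) by blast
qed

text \<open>\<open>m\<close> is a limit of normalised orbit sums, hence defined on all subsets but
  only finitely additive. A preimage under \<open>\<alpha>\<close> has the mass given by the
  push-forward under \<open>\<alpha>\<close>; at this stage only the cocycle identity contributes,
  with one factor \<open>exp (\<delta> * \<kappa>)\<close>.\<close>

lemma averaged_content:
  "\<exists>m :: 'm set \<Rightarrow> real. (\<forall>S. 0 \<le> m S) \<and> m UNIV = 1 \<and>
    (\<forall>S T. S \<inter> T = {} \<longrightarrow> m (S \<union> T) = m S + m T) \<and>
    (\<forall>\<alpha>\<in>\<Gamma>. \<forall>S c. (\<forall>x\<in>S. c \<le> \<sigma> (iv \<alpha>) x) \<longrightarrow> m (\<alpha> -` S) \<le> exp (\<delta> * \<kappa> - \<delta> * c) * m S) \<and>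
    (\<forall>\<alpha>\<in>\<Gamma>. \<forall>S c. (\<forall>x\<in>S. \<sigma> (iv \<alpha>) x \<le> c) \<longrightarrow> m S \<le> exp (\<delta> * \<kappa> + \<delta> * c) * m (\<alpha> -` S)) \<and>
    (\<forall>K. compact K \<longrightarrow> K \<inter> limit_set \<Gamma> = {} \<longrightarrow> m K = 0)"
proof -

  \<comment> \<open>Weights and unnormalised orbit sums\<close>
  obtain b :: "nat \<Rightarrow> real \<Rightarrow> real" where b_pos: "\<And>n u. 0 < b n u"
    and b_slow: "\<And>n u v. b n u \<le> exp (\<bar>u - v\<bar> / real (Suc n)) * b n v"
    and b_bound: "\<And>n u. b n u \<le> exp \<bar>u\<bar>"
    and b_sum: "\<And>n. (\<lambda>g. exp (- \<delta> * mag g) * b n (mag g)) summable_on \<Gamma>"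
    and b_div: "\<And>n. real n \<le> (\<Sum>\<^sub>\<infinity>g\<in>\<Gamma>. exp (- \<delta> * mag g) * b n (mag g))"
    using slowly_varying_weights[OF crit infinite_\<Gamma>] by auto
  obtain C where C0: "C > 0" and C: "\<And>p g. g \<in> \<Gamma> \<Longrightarrow> d (Inr p) (Inl (iv g)) > \<epsilon> \<Longrightarrow> \<bar>\<sigma> g p - mag g\<bar> \<le> C"
    using magnitude_bound by blast
  obtain Dc where Dc: "Dc > 0" "\<And>g p. g \<in> \<Gamma> \<Longrightarrow> cutoff g p \<le> Dc" using cutoff_bounded by blast
  define A where "A n g = exp (- \<delta> * mag g) * b n (mag g)" for n g
  define T where "T n = infsum (A n) \<Gamma>" for n
  define w where "w n = orbit_weight (b n)" for n
  define L where "L = Dc * exp (\<delta> * C)"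
  \<comment> \<open>Unnormalised mass of \<open>S\<close>. The constants \<open>L\<close> and
    \<open>c0\<close> bound it above and below against the total \<open>T n\<close> of the weighted
    series.\<close>
  define N where "N n S = (\<Sum>p\<in>P. \<Sum>\<^sub>\<infinity>h\<in>\<Gamma>. indicator S (h p) * w n h p)" for n S
  define c0 where "c0 = \<epsilon> * exp (- \<delta> * C)"
  have c0: "c0 > 0" using eps_pos by (simp add: c0_def)
  have A_pos: "0 < A n g" for n g using b_pos by (simp add: A_def)
  have A_sum: "A n summable_on \<Gamma>" for n using b_sum[of n] unfolding A_def .
  have T_ge: "real n \<le> T n" for n using b_div[of n] unfolding T_def A_def .
  have A_bound: "A n g \<le> exp (- \<delta> * mag g) * exp \<bar>mag g\<bar>" for n g
    unfolding A_def using b_bound by (intro mult_left_mono) auto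
  have w_nonneg: "0 \<le> w n g p" for n g p
    unfolding w_def orbit_weight_def using b_pos cutoff_nonneg by (simp add: less_imp_le)
  have w_le: "w n g p \<le> L * A n g" if "g \<in> \<Gamma>" for n g p
  proof -
    have "w n g p \<le> cutoff g p * (exp (\<delta> * C) * A n g)"
      unfolding w_def A_def by (rule orbit_weight_le[OF C b_pos that])
    also have "\<dots> \<le> Dc * (exp (\<delta> * C) * A n g)"
      using Dc(2)[OF that] A_pos by (intro mult_right_mono) (auto simp: less_imp_le)
    finally show ?thesis by (simp add: L_def mult.assoc)
  qed
  have ind_sum: "(\<lambda>h. indicator S (h p) * w n h p) summable_on \<Gamma>" for S p n
    by (rule summable_on_nonneg_comparison[OF summable_on_cmult_right[OF A_sum, of L]])
      (use w_nonneg w_le in \<open>auto simp: indicator_def intro: order_trans[OF w_nonneg w_le]\<close>)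
  have N_nonneg: "0 \<le> N n S" for n S
    unfolding N_def by (intro sum_nonneg infsum_nonneg mult_nonneg_nonneg w_nonneg) simp
  have N_add: "N n (S \<union> S') = N n S + N n S'" if "S \<inter> S' = {}" for n S S'
  proof -
    have "(\<Sum>\<^sub>\<infinity>h\<in>\<Gamma>. indicator (S \<union> S') (h p) * w n h p) =
      (\<Sum>\<^sub>\<infinity>h\<in>\<Gamma>. indicator S (h p) * w n h p) + (\<Sum>\<^sub>\<infinity>h\<in>\<Gamma>. indicator S' (h p) * w n h p)" for p
    proof -
      have "(\<Sum>\<^sub>\<infinity>h\<in>\<Gamma>. indicator (S \<union> S') (h p) * w n h p) =
        (\<Sum>\<^sub>\<infinity>h\<in>\<Gamma>. indicator S (h p) * w n h p + indicator S' (h p) * w n h p)"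
        by (rule infsum_cong) (use that in \<open>auto simp: indicator_def\<close>)
      also have "\<dots> = (\<Sum>\<^sub>\<infinity>h\<in>\<Gamma>. indicator S (h p) * w n h p) + (\<Sum>\<^sub>\<infinity>h\<in>\<Gamma>. indicator S' (h p) * w n h p)"
        by (rule infsum_add[OF ind_sum ind_sum])
      finally show ?thesis .
    qed
    then show ?thesis by (simp add: N_def sum.distrib)
  qed
  have N_le: "N n S \<le> N n UNIV" for n S
    using N_add[of S "- S" n] N_nonneg[of n "- S"] by simp
  \<comment> \<open>Every \<open>h\<close> has a base point with cutoff at least
    \<open>\<epsilon>\<close>, so the total mass diverges along with \<open>T n\<close>.\<close>
  have N_ge: "c0 * T n \<le> N n UNIV" for n
  proof -
    have "c0 * T n = (\<Sum>\<^sub>\<infinity>h\<in>\<Gamma>. c0 * A n h)" unfolding T_def by (rule infsum_cmult_right'[symmetric])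
    also have "\<dots> \<le> (\<Sum>\<^sub>\<infinity>h\<in>\<Gamma>. \<Sum>p\<in>P. indicator UNIV (h p) * w n h p)"
    proof (rule infsum_mono)
      show "(\<lambda>h. c0 * A n h) summable_on \<Gamma>" by (rule summable_on_cmult_right[OF A_sum])
      show "(\<lambda>h. \<Sum>p\<in>P. indicator UNIV (h p) * w n h p) summable_on \<Gamma>"
        by (rule infsum_finite_sum(1)[OF finite_P]) (rule ind_sum)
      fix h assume h: "h \<in> \<Gamma>"
      obtain p where p: "p \<in> P" "d (Inr p) (Inl (iv h)) > 2 * \<epsilon>"
        using far_point[of "iv h" "iv h"] iv_mem[OF h] by blast
      have "\<epsilon> \<le> cutoff h p" using p(2) by (simp add: cutoff_def)
      then have "c0 * A n h \<le> cutoff h p * (exp (- \<delta> * C) * A n h)"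
        using A_pos[of n h] unfolding c0_def mult.assoc
        by (intro mult_right_mono) (auto simp: less_imp_le)
      also have "\<dots> \<le> w n h p"
        unfolding w_def A_def by (rule orbit_weight_ge[OF C b_pos h])
      also have "\<dots> \<le> (\<Sum>p\<in>P. w n h p)"
        by (rule member_le_sum) (use p finite_P w_nonneg in auto)
      finally show "c0 * A n h \<le> (\<Sum>p\<in>P. indicator UNIV (h p) * w n h p)" by simp
    qed
    also have "\<dots> = N n UNIV" unfolding N_def by (rule infsum_finite_sum(2)[OF finite_P]) (rule ind_sum)
    finally show ?thesis .
  qed

  \<comment> \<open>Limits of the normalised masses\<close>
  define f where "f n S = N n S / N n UNIV" for n S
  have "f n S \<in> {0..1}" for n S
    using N_nonneg[of n S] N_le[of n S] by (auto simp: f_def divide_le_eq_1)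
  then obtain F m where F: "F \<noteq> bot" "F \<le> sequentially" and lim: "\<And>S. ((\<lambda>n. f n S) \<longlongrightarrow> m S) F"
    using pointwise_convergent_along_filter[of f 0 1] by blast
  \<comment> \<open>At \<open>n = 0\<close> the lower bound for \<open>T n\<close> is vacuous, so
    positivity of the denominators is used from \<open>n = 1\<close> on.\<close>
  have ev1: "\<forall>\<^sub>F n in F. 1 \<le> n"
    using F(2) eventually_ge_at_top[of 1] unfolding le_filter_def by blast
  have T_pos: "0 < T n" if "1 \<le> n" for n using T_ge[of n] that by linarith
  have NU_pos: "0 < N n UNIV" if "1 \<le> n" for n
    using N_ge[of n] mult_pos_pos[OF c0 T_pos[OF that]] by linarith
  \<comment> \<open>Inequalities between masses pass to the limit if the additive error is
    negligible relative to \<open>T n\<close>, because the normalising mass is at least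
    \<open>c0 * T n\<close>.\<close>
  have compare: "m S \<le> q' * m S'"
    if N: "\<And>n. N n S \<le> q n * N n S' + cst * R n" and q: "q \<longlonglongrightarrow> q'"
      and R: "(\<lambda>n. R n / T n) \<longlonglongrightarrow> 0" "\<And>n. 0 \<le> R n" and cst: "0 \<le> cst" for S S' q q' R cst
  proof (rule tendsto_le[OF F(1) _ lim])
    have "((\<lambda>n. q n * f n S' + cst / c0 * (R n / T n)) \<longlongrightarrow> q' * m S' + cst / c0 * 0) F"
      by (intro tendsto_intros lim filterlim_mono[OF q] filterlim_mono[OF R(1)] F(2) order_refl)
    then show "((\<lambda>n. q n * f n S' + cst / c0 * (R n / T n)) \<longlongrightarrow> q' * m S') F" by simp
    show "\<forall>\<^sub>F n in F. f n S \<le> q n * f n S' + cst / c0 * (R n / T n)"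
      using ev1
    proof eventually_elim
      case (elim n)
      have "f n S \<le> (q n * N n S' + cst * R n) / N n UNIV"
        unfolding f_def by (intro divide_right_mono N N_nonneg)
      also have "\<dots> = q n * f n S' + cst * R n / N n UNIV"
        by (simp add: f_def add_divide_distrib)
      also have "cst * R n / N n UNIV \<le> cst * R n / (c0 * T n)"
        using c0 T_pos[OF elim] NU_pos[OF elim] cst R(2)[of n] N_ge[of n]
        by (intro divide_left_mono) auto
      finally show ?case by simp
    qed
  qed
  have sum_compare: "(\<Sum>p\<in>P. infsum (x p) \<Gamma>) \<le> q * (\<Sum>p\<in>P. infsum (y p) \<Gamma>)
      + real (card P) * M * infsum (\<lambda>h. E h * A n h) \<Gamma>"
    if x: "\<And>p. x p summable_on \<Gamma>" and y: "\<And>p. y p summable_on \<Gamma>"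
      and EA: "(\<lambda>h. E h * A n h) summable_on \<Gamma>"
      and le: "\<And>p h. h \<in> \<Gamma> \<Longrightarrow> x p h \<le> q * y p h + M * (E h * A n h)"
    for x y :: "'m \<Rightarrow> ('m \<Rightarrow> 'm) \<Rightarrow> real" and q M n E
  proof -
    have "infsum (x p) \<Gamma> \<le> q * infsum (y p) \<Gamma> + M * infsum (\<lambda>h. E h * A n h) \<Gamma>" for p
    proof -
      have "infsum (x p) \<Gamma> \<le> infsum (\<lambda>h. q * y p h + M * (E h * A n h)) \<Gamma>"
        by (intro infsum_mono x summable_on_add summable_on_cmult_right y EA le)
      also have "\<dots> = infsum (\<lambda>h. q * y p h) \<Gamma> + infsum (\<lambda>h. M * (E h * A n h)) \<Gamma>"
        by (intro infsum_add summable_on_cmult_right y EA)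
      finally show ?thesis by (simp only: infsum_cmult_right')
    qed
    then have "(\<Sum>p\<in>P. infsum (x p) \<Gamma>) \<le> (\<Sum>p\<in>P. q * infsum (y p) \<Gamma> + M * infsum (\<lambda>h. E h * A n h) \<Gamma>)"
      by (rule sum_mono)
    then show ?thesis by (simp add: sum.distrib sum_distrib_left mult.assoc)
  qed
  have avg: "(\<lambda>h. E h * A n h) summable_on \<Gamma>"
    "(\<lambda>n. infsum (\<lambda>h. E h * A n h) \<Gamma> / T n) \<longlonglongrightarrow> 0"
    "0 \<le> infsum (\<lambda>h. E h * A n h) \<Gamma>"
    if E: "\<And>h. h \<in> \<Gamma> \<Longrightarrow> 0 \<le> E h" "\<And>h. h \<in> \<Gamma> \<Longrightarrow> E h \<le> B"
      "\<And>e. 0 < e \<Longrightarrow> finite {h\<in>\<Gamma>. e \<le> E h}" for E B n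
  proof -
    note * = weighted_average_of_vanishing[of \<Gamma> A, OF less_imp_le[OF A_pos] A_sum A_bound
        T_ge[unfolded T_def] E]
    show "(\<lambda>h. E h * A n h) summable_on \<Gamma>" by (rule *(1))
    show "(\<lambda>n. infsum (\<lambda>h. E h * A n h) \<Gamma> / T n) \<longlonglongrightarrow> 0" unfolding T_def by (rule *(2))
    show "0 \<le> infsum (\<lambda>h. E h * A n h) \<Gamma>"
      by (intro infsum_nonneg mult_nonneg_nonneg E(1) less_imp_le[OF A_pos])
  qed

  \<comment> \<open>Effect of translating by a group element\<close>
  have reindex: "N n (\<alpha> -` S) = (\<Sum>p\<in>P. \<Sum>\<^sub>\<infinity>h\<in>\<Gamma>. indicator S (h p) * w n (iv \<alpha> \<circ> h) p)"
    and shifted_sum: "(\<lambda>h. indicator S (h p) * w n (iv \<alpha> \<circ> h) p) summable_on \<Gamma>"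
    if \<alpha>: "\<alpha> \<in> \<Gamma>" for \<alpha> S n p
  proof -
    \<comment> \<open>Substituting \<open>iv \<alpha> \<circ> h\<close> for \<open>h\<close> turns
      membership in the preimage of \<open>S\<close> into membership in \<open>S\<close>; the two
      masses then run over the same pairs and differ only in their weights.\<close>
    have bij: "bij_betw (\<lambda>h. iv \<alpha> \<circ> h) \<Gamma> \<Gamma>"
      by (rule bij_betw_byWitness[where f' = "\<lambda>h. \<alpha> \<circ> h"])
        (use \<alpha> in \<open>auto simp: fun_eq_iff\<close>)
    have eq: "indicator (\<alpha> -` S) ((iv \<alpha> \<circ> h) p) * w n (iv \<alpha> \<circ> h) p
      = indicator S (h p) * w n (iv \<alpha> \<circ> h) p" for h p n
      using \<alpha> by (simp add: indicator_def)
    have "(\<Sum>\<^sub>\<infinity>h\<in>\<Gamma>. indicator (\<alpha> -` S) (h p) * w n h p) =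
      (\<Sum>\<^sub>\<infinity>h\<in>\<Gamma>. indicator S (h p) * w n (iv \<alpha> \<circ> h) p)" for p
      using infsum_reindex_bij_betw[OF bij, of "\<lambda>h. indicator (\<alpha> -` S) (h p) * w n h p"]
      unfolding eq by simp
    then show "N n (\<alpha> -` S) = (\<Sum>p\<in>P. \<Sum>\<^sub>\<infinity>h\<in>\<Gamma>. indicator S (h p) * w n (iv \<alpha> \<circ> h) p)"
      unfolding N_def by simp
    show "(\<lambda>h. indicator S (h p) * w n (iv \<alpha> \<circ> h) p) summable_on \<Gamma>"
      using summable_on_reindex_bij_betw[OF bij, of "\<lambda>h. indicator (\<alpha> -` S) (h p) * w n h p"]
        ind_sum[of "\<alpha> -` S" p n] unfolding eq by simp
  qed
  define E where "E \<alpha> h = d (Inl (iv h \<circ> \<alpha>)) (Inl (iv h))" for \<alpha> h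
  obtain B where B: "\<And>x y. x \<in> \<Gamma> <+> UNIV \<Longrightarrow> y \<in> \<Gamma> <+> UNIV \<Longrightarrow> d x y \<le> B"
    using d_bounded by blast
  have E: "\<And>h. h \<in> \<Gamma> \<Longrightarrow> 0 \<le> E \<alpha> h" "\<And>h. h \<in> \<Gamma> \<Longrightarrow> E \<alpha> h \<le> B"
    "\<And>e. 0 < e \<Longrightarrow> finite {h\<in>\<Gamma>. e \<le> E \<alpha> h}" if "\<alpha> \<in> \<Gamma>" for \<alpha>
    using that right_translation_displacement_finite[OF that] B by (auto simp: E_def)
  have q_lim: "(\<lambda>n. exp (D / real (Suc n)) * k) \<longlonglongrightarrow> k" for D k :: real
  proof -
    have "(\<lambda>n. D / real (Suc n)) \<longlonglongrightarrow> 0"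
      by (rule LIMSEQ_Suc[OF lim_const_over_n])
    then have "(\<lambda>n. exp (D / real (Suc n)) * k) \<longlonglongrightarrow> exp 0 * k"
      by (intro tendsto_intros)
    then show ?thesis by simp
  qed
  have upper: "m (\<alpha> -` S) \<le> exp (\<delta> * \<kappa> - \<delta> * c) * m S"
    if \<alpha>: "\<alpha> \<in> \<Gamma>" and c: "\<And>x. x \<in> S \<Longrightarrow> c \<le> \<sigma> (iv \<alpha>) x" for \<alpha> S c
  proof -
    obtain D where D: "D \<ge> 0" "\<And>g. g \<in> \<Gamma> \<Longrightarrow> \<bar>mag (iv \<alpha> \<circ> g) - mag g\<bar> \<le> D"
      using magnitude_translate[OF iv_mem[OF \<alpha>]] by blast
    let ?k = "exp (\<delta> * \<kappa> - \<delta> * c)" and ?M = "exp (\<delta> * C) * (exp (\<delta> * D) * exp D)"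
    \<comment> \<open>The error from \<open>orbit_weight_compare\<close> carries the series term at
      \<open>iv \<alpha> \<circ> h\<close>; bounded variation of the magnitude converts it to the
      term at \<open>h\<close>, uniformly in \<open>n\<close>.\<close>
    have A_shift: "A n (iv \<alpha> \<circ> h) \<le> exp (\<delta> * D) * exp D * A n h" if h: "h \<in> \<Gamma>" for n h
    proof -
      have "\<delta> * (mag h - mag (iv \<alpha> \<circ> h)) \<le> \<delta> * D"
        using D(2)[OF h] \<delta>_nonneg by (intro mult_left_mono) auto
      then have 1: "exp (- \<delta> * mag (iv \<alpha> \<circ> h)) \<le> exp (\<delta> * D) * exp (- \<delta> * mag h)"
        by (simp add: exp_add[symmetric] algebra_simps)
      have "\<bar>mag (iv \<alpha> \<circ> h) - mag h\<bar> / real (Suc n) \<le> D / 1"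
        using D(1) D(2)[OF h] by (intro frac_le) auto
      then have "exp (\<bar>mag (iv \<alpha> \<circ> h) - mag h\<bar> / real (Suc n)) * b n (mag h) \<le> exp D * b n (mag h)"
        using b_pos by (intro mult_right_mono) (auto simp: less_imp_le)
      with b_slow have 2: "b n (mag (iv \<alpha> \<circ> h)) \<le> exp D * b n (mag h)" by (rule order_trans)
      show ?thesis
        using mult_mono[OF 1 2] b_pos by (simp add: A_def less_imp_le mult_ac)
    qed
    show ?thesis
    proof (rule compare[OF _ q_lim avg(2,3)[OF E[OF \<alpha>]]])
      show "0 \<le> real (card P) * ?M" by simp
      fix n
      show "N n (\<alpha> -` S) \<le> exp (D / real (Suc n)) * ?k * N n S
        + real (card P) * ?M * infsum (\<lambda>h. E \<alpha> h * A n h) \<Gamma>"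
        unfolding reindex[OF \<alpha>] unfolding N_def
      proof (rule sum_compare[OF shifted_sum[OF \<alpha>] ind_sum avg(1)[OF E[OF \<alpha>]]])
        fix p h assume h: "h \<in> \<Gamma>"
        show "indicator S (h p) * w n (iv \<alpha> \<circ> h) p
          \<le> exp (D / real (Suc n)) * ?k * (indicator S (h p) * w n h p) + ?M * (E \<alpha> h * A n h)"
        proof (cases "h p \<in> S")
          case True
          \<comment> \<open>The error \<open>\<kappa>\<close> of the cocycle identity is the source
            of the factor \<open>exp (\<delta> * \<kappa>)\<close>.\<close>
          have "\<sigma> (iv \<alpha> \<circ> h) p \<ge> c + \<sigma> h p - \<kappa>"
            using cocycle_ineq[OF iv_mem[OF \<alpha>] h, of p] c[OF True] by linarith
          then have "\<delta> * (c + \<sigma> h p - \<kappa>) \<le> \<delta> * \<sigma> (iv \<alpha> \<circ> h) p"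
            using \<delta>_nonneg by (rule mult_left_mono)
          then have k: "exp (- \<delta> * \<sigma> (iv \<alpha> \<circ> h) p) \<le> ?k * exp (- \<delta> * \<sigma> h p)"
            by (simp add: exp_add[symmetric] algebra_simps)
          have "w n (iv \<alpha> \<circ> h) p \<le> exp (D / real (Suc n)) * ?k * w n h p
              + E \<alpha> h * (exp (\<delta> * C) * A n (iv \<alpha> \<circ> h))"
            unfolding w_def A_def
            by (rule orbit_weight_compare[OF C b_pos _ b_slow D(2)[OF h] _ k])
              (use cutoff_translate[OF \<alpha> h] \<alpha> h in \<open>auto simp: E_def\<close>)
          also have "\<dots> \<le> exp (D / real (Suc n)) * ?k * w n h p
              + E \<alpha> h * (exp (\<delta> * C) * (exp (\<delta> * D) * exp D * A n h))"
            using A_shift[OF h] E(1)[OF \<alpha> h] by (intro add_left_mono mult_left_mono) auto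
          finally show ?thesis using True by (simp add: mult_ac)
        next
          case False
          then show ?thesis using E(1)[OF \<alpha> h] A_pos[of n h] by (simp add: less_imp_le)
        qed
      qed
    qed
  qed
  \<comment> \<open>The same comparison with \<open>h\<close> and
    \<open>iv \<alpha> \<circ> h\<close> exchanged; its error already carries the series term at
    \<open>h\<close>.\<close>
  have lower: "m S \<le> exp (\<delta> * \<kappa> + \<delta> * c) * m (\<alpha> -` S)"
    if \<alpha>: "\<alpha> \<in> \<Gamma>" and c: "\<And>x. x \<in> S \<Longrightarrow> \<sigma> (iv \<alpha>) x \<le> c" for \<alpha> S c
  proof -
    obtain D where D: "D \<ge> 0" "\<And>g. g \<in> \<Gamma> \<Longrightarrow> \<bar>mag (iv \<alpha> \<circ> g) - mag g\<bar> \<le> D"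
      using magnitude_translate[OF iv_mem[OF \<alpha>]] by blast
    let ?k = "exp (\<delta> * \<kappa> + \<delta> * c)" and ?M = "exp (\<delta> * C)"
    show ?thesis
    proof (rule compare[OF _ q_lim avg(2,3)[OF E[OF \<alpha>]]])
      show "0 \<le> real (card P) * ?M" by simp
      fix n
      show "N n S \<le> exp (D / real (Suc n)) * ?k * N n (\<alpha> -` S)
        + real (card P) * ?M * infsum (\<lambda>h. E \<alpha> h * A n h) \<Gamma>"
        unfolding reindex[OF \<alpha>] unfolding N_def
      proof (rule sum_compare[OF ind_sum shifted_sum[OF \<alpha>] avg(1)[OF E[OF \<alpha>]]])
        fix p h assume h: "h \<in> \<Gamma>"
        show "indicator S (h p) * w n h p
          \<le> exp (D / real (Suc n)) * ?k * (indicator S (h p) * w n (iv \<alpha> \<circ> h) p) + ?M * (E \<alpha> h * A n h)"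
        proof (cases "h p \<in> S")
          case True
          have "\<sigma> (iv \<alpha> \<circ> h) p \<le> c + \<sigma> h p + \<kappa>"
            using cocycle_ineq[OF iv_mem[OF \<alpha>] h, of p] c[OF True] by linarith
          then have "\<delta> * \<sigma> (iv \<alpha> \<circ> h) p \<le> \<delta> * (c + \<sigma> h p + \<kappa>)"
            using \<delta>_nonneg by (rule mult_left_mono)
          then have k: "exp (- \<delta> * \<sigma> h p) \<le> ?k * exp (- \<delta> * \<sigma> (iv \<alpha> \<circ> h) p)"
            by (simp add: exp_add[symmetric] algebra_simps)
          have mD: "\<bar>mag h - mag (iv \<alpha> \<circ> h)\<bar> \<le> D" using D(2)[OF h] by linarith
          have cE: "\<bar>cutoff h p - cutoff (iv \<alpha> \<circ> h) p\<bar> \<le> E \<alpha> h"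
            using cutoff_translate[OF \<alpha> h, of p] unfolding E_def by linarith
          have "w n h p \<le> exp (D / real (Suc n)) * ?k * w n (iv \<alpha> \<circ> h) p
              + E \<alpha> h * (exp (\<delta> * C) * A n h)"
            unfolding w_def A_def
            by (rule orbit_weight_compare[OF C b_pos h b_slow mD cE k])
          then show ?thesis using True by (simp add: mult_ac)
        next
          case False
          then show ?thesis using E(1)[OF \<alpha> h] A_pos[of n h] by (simp add: less_imp_le)
        qed
      qed
    qed
  qed
  have support: "m K = 0" if K: "compact K" "K \<inter> limit_set \<Gamma> = {}" for K
  proof -
    define V where "V = (\<Union>p\<in>P. {h\<in>\<Gamma>. h p \<in> K \<and> 0 < cutoff h p})"
    define e where "e h = (if h \<in> V then 1 else 0 :: real)" for h
    have V: "finite V" unfolding V_def using finite_P finite_visits_off_limit_set[OF K] by blast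
    have e: "\<And>h. h \<in> \<Gamma> \<Longrightarrow> 0 \<le> e h" "\<And>h. h \<in> \<Gamma> \<Longrightarrow> e h \<le> 1"
      "\<And>r. 0 < r \<Longrightarrow> finite {h\<in>\<Gamma>. r \<le> e h}"
    proof -
      show "finite {h\<in>\<Gamma>. r \<le> e h}" if "0 < r" for r
        by (rule finite_subset[OF _ V]) (use that in \<open>auto simp: e_def split: if_splits\<close>)
    qed (auto simp: e_def)
    have L0: "0 \<le> L" using Dc by (simp add: L_def)
    \<comment> \<open>Comparison with factor 0: all mass in \<open>K\<close> comes from the finite
      set \<open>V\<close>, so it is entirely an error term.\<close>
    have "m K \<le> 0 * m K"
    proof (rule compare[OF _ tendsto_const avg(2,3)[OF e]])
      show "0 \<le> real (card P) * L" using L0 by simp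
      fix n
      have 1: "(\<Sum>\<^sub>\<infinity>h\<in>\<Gamma>. indicator K (h p) * w n h p) \<le> L * (\<Sum>\<^sub>\<infinity>h\<in>\<Gamma>. e h * A n h)"
        if p: "p \<in> P" for p
      proof -
        have "(\<Sum>\<^sub>\<infinity>h\<in>\<Gamma>. indicator K (h p) * w n h p) \<le> (\<Sum>\<^sub>\<infinity>h\<in>\<Gamma>. L * (e h * A n h))"
        proof (rule infsum_mono[OF ind_sum summable_on_cmult_right[OF avg(1)[OF e]]])
          fix h assume h: "h \<in> \<Gamma>"
          show "indicator K (h p) * w n h p \<le> L * (e h * A n h)"
          proof (cases "h p \<in> K \<and> 0 < cutoff h p")
            case True
            then have "e h = 1" using p h by (auto simp: e_def V_def)
            then show ?thesis using True w_le[OF h, of n p] by simp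
          next
            case False
            then have "indicator K (h p) * w n h p = 0"
              using cutoff_nonneg[of h p] by (auto simp: w_def orbit_weight_def indicator_def)
            moreover have "0 \<le> L * (e h * A n h)"
              using L0 e(1)[OF h] A_pos[of n h] by (simp add: less_imp_le)
            ultimately show ?thesis by linarith
          qed
        qed
        then show ?thesis by (simp only: infsum_cmult_right')
      qed
      have "N n K \<le> (\<Sum>p\<in>P. L * (\<Sum>\<^sub>\<infinity>h\<in>\<Gamma>. e h * A n h))"
        unfolding N_def by (rule sum_mono) (rule 1)
      then show "N n K \<le> 0 * N n K + real (card P) * L * (\<Sum>\<^sub>\<infinity>h\<in>\<Gamma>. e h * A n h)"
        by (simp add: mult.assoc)
    qed
    moreover have "0 \<le> m K"
      by (rule tendsto_lowerbound[OF lim _ F(1)]) (simp add: f_def N_nonneg)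
    ultimately show ?thesis by simp
  qed
  have "0 \<le> m S" for S
    by (rule tendsto_lowerbound[OF lim _ F(1)]) (simp add: f_def N_nonneg)
  moreover have "m UNIV = 1"
  proof (rule tendsto_unique[OF F(1) lim])
    have "\<forall>\<^sub>F n in F. f n UNIV = 1"
      using ev1 by eventually_elim (use NU_pos in \<open>force simp: f_def\<close>)
    then show "((\<lambda>n. f n UNIV) \<longlongrightarrow> 1) F" by (rule tendsto_eventually)
  qed
  moreover have "m (S \<union> S') = m S + m S'" if "S \<inter> S' = {}" for S S'
  proof (rule tendsto_unique[OF F(1) lim])
    show "((\<lambda>n. f n (S \<union> S')) \<longlongrightarrow> m S + m S') F"
      using tendsto_add[OF lim lim, of S S'] by (simp add: f_def N_add[OF that] add_divide_distrib)
  qed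
  ultimately show ?thesis
    using upper lower support by (intro exI[of _ m]) auto
qed

end

section \<open>The Patterson--Sullivan measure\<close>

text \<open>Test the hypothesis on the part of \<open>V\<close> where \<open>g x < f x\<close>: were
  it not null, finiteness of the integral of \<open>g\<close> would make the integrals strictly
  ordered the wrong way.\<close>

lemma AE_le_of_set_nn_integral_le:
  assumes f [measurable]: "f \<in> borel_measurable M" and g [measurable]: "g \<in> borel_measurable M"
    and V [measurable]: "V \<in> sets M"
    and le: "\<And>A. A \<in> sets M \<Longrightarrow> A \<subseteq> V \<Longrightarrow>
      (\<integral>\<^sup>+x. f x * indicator A x \<partial>M) \<le> (\<integral>\<^sup>+x. g x * indicator A x \<partial>M)"
    and fin: "(\<integral>\<^sup>+x. g x * indicator V x \<partial>M) < \<infinity>"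
  shows "AE x in M. x \<in> V \<longrightarrow> f x \<le> g x"
proof -
  define A where "A = {x\<in>space M. x \<in> V \<and> g x < f x}"
  have A [measurable]: "A \<in> sets M" unfolding A_def by measurable
  have "(\<integral>\<^sup>+x. g x * indicator A x \<partial>M) \<le> (\<integral>\<^sup>+x. g x * indicator V x \<partial>M)"
    by (intro nn_integral_mono) (auto simp: A_def indicator_def)
  then have finA: "(\<integral>\<^sup>+x. g x * indicator A x \<partial>M) \<noteq> \<infinity>" using fin by auto
  have "AE x in M. f x * indicator A x \<le> g x * indicator A x"
  proof (rule ccontr)
    assume "\<not> (AE x in M. f x * indicator A x \<le> g x * indicator A x)"
    then have "(\<integral>\<^sup>+x. g x * indicator A x \<partial>M) < (\<integral>\<^sup>+x. f x * indicator A x \<partial>M)"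
      by (intro nn_integral_less) (use finA in \<open>auto simp: A_def indicator_def less_imp_le\<close>)
    moreover have "(\<integral>\<^sup>+x. f x * indicator A x \<partial>M) \<le> (\<integral>\<^sup>+x. g x * indicator A x \<partial>M)"
      by (rule le[OF A]) (auto simp: A_def)
    ultimately show False by simp
  qed
  then show ?thesis
    using AE_space
  proof eventually_elim
    case (elim x)
    then show ?case by (cases "x \<in> A") (auto simp: A_def not_less)
  qed
qed

lemma ennreal_le_mult_of_divide_le:
  assumes "x / ennreal k \<le> y" "0 < k" shows "x \<le> ennreal k * y"
proof -
  have "x = x * ennreal k / ennreal k" using assms(2) by (simp add: ennreal_mult_divide_eq)
  also have "\<dots> = ennreal k * (x / ennreal k)" by (simp add: ennreal_times_divide mult.commute)
  also have "\<dots> \<le> ennreal k * y" using assms(1) by (rule mult_left_mono) simp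
  finally show ?thesis .
qed

text \<open>A null set meets each \<open>V c\<close> in a null set of the other measure, and the
  rational index makes the cover countable.\<close>

lemma null_set_of_open_cover_bound:
  fixes V :: "rat \<Rightarrow> 'a::topological_space set"
  assumes "sets M = sets borel" "sets N = sets borel"
    and V: "\<And>c. open (V c)" "(\<Union>c. V c) = UNIV"
    and le: "\<And>c A. A \<in> sets borel \<Longrightarrow> A \<subseteq> V c \<Longrightarrow> emeasure N A \<le> k c * emeasure M A"
  shows "absolutely_continuous M N"
  unfolding absolutely_continuous_def
proof
  fix A assume A: "A \<in> null_sets M"
  then have Ab: "A \<in> sets borel" using assms(1) by auto
  have "A \<inter> V c \<in> null_sets N" for c
  proof -
    have b: "A \<inter> V c \<in> sets borel" using Ab V(1) by auto
    have "A \<inter> V c \<in> null_sets M" using A b assms(1) by (intro null_sets_subset[OF A]) auto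
    then have "emeasure N (A \<inter> V c) \<le> 0" using le[OF b, of c] by (simp add: null_setsD1)
    then show ?thesis using b assms(2) by auto
  qed
  then have "(\<Union>c. A \<inter> V c) \<in> null_sets N" by (intro null_sets_UN) auto
  moreover have "(\<Union>c. A \<inter> V c) = A" using V(2) by auto
  ultimately show "A \<in> null_sets N" by simp
qed

context coarse_cocycle_with_magnitude
begin

lemma continuous_element: "g \<in> \<Gamma> \<Longrightarrow> continuous_on A g"
  using homeomorphic_imp_continuous_map[OF homeo] continuous_on_subset[of UNIV g A] by auto

lemma patterson_sullivan_measure_exists:
  "\<exists>\<mu> :: 'm measure. patterson_sullivan \<Gamma> \<sigma> (2 * \<kappa> * \<delta>) \<delta> \<mu> \<and> emeasure \<mu> (limit_set \<Gamma>) = 1"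
proof -
  obtain m :: "'m set \<Rightarrow> real" where m_all: "\<forall>S. 0 \<le> m S" "\<forall>S T. S \<inter> T = {} \<longrightarrow> m (S \<union> T) = m S + m T"
    "\<forall>\<alpha>\<in>\<Gamma>. \<forall>S c. (\<forall>x\<in>S. c \<le> \<sigma> (iv \<alpha>) x) \<longrightarrow> m (\<alpha> -` S) \<le> exp (\<delta> * \<kappa> - \<delta> * c) * m S"
    "\<forall>\<alpha>\<in>\<Gamma>. \<forall>S c. (\<forall>x\<in>S. \<sigma> (iv \<alpha>) x \<le> c) \<longrightarrow> m S \<le> exp (\<delta> * \<kappa> + \<delta> * c) * m (\<alpha> -` S)"
    "\<forall>K. compact K \<longrightarrow> K \<inter> limit_set \<Gamma> = {} \<longrightarrow> m K = 0"
    and m1: "m UNIV = 1"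
    using averaged_content by (elim exE conjE)
  note m0 = m_all(1)[rule_format] and add = m_all(2)[rule_format]
    and upper = m_all(3)[rule_format] and lower = m_all(4)[rule_format]
    and support = m_all(5)[rule_format]
  have mono: "m S \<le> m T" if "S \<subseteq> T" for S T
  proof -
    have "S \<union> (T - S) = T" using that by auto
    then show ?thesis using add[of S "T - S"] m0[of "T - S"] by auto
  qed

  \<comment> \<open>The Borel measure obtained from the content\<close>
  have "\<exists>\<mu>. sets \<mu> = sets borel \<and>
    (\<forall>U. open U \<longrightarrow> emeasure \<mu> U = (SUP K\<in>{K. compact K \<and> K \<subseteq> U}. ennreal (m K))) \<and>
    (\<forall>A\<in>sets borel. emeasure \<mu> A = (INF U\<in>{U. open U \<and> A \<subseteq> U}. emeasure \<mu> U))"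
  proof (rule compact_content_extends_to_borel_measure[OF compact_M])
    show "ennreal (m {}) = 0" using add[of "{}" "{}"] by simp
    show "ennreal (m A) \<le> ennreal (m B)" if "A \<subseteq> B" for A B
      by (intro ennreal_leI mono that)
    show "ennreal (m (A \<union> B)) \<le> ennreal (m A) + ennreal (m B)" for A B
    proof -
      have "m (A \<union> B) = m A + m (B - A)" using add[of A "B - A"] by simp
      also have "\<dots> \<le> m A + m B" using mono[of "B - A" B] by auto
      finally show ?thesis using m0 by (simp add: ennreal_plus[symmetric] ennreal_leI del: ennreal_plus)
    qed
    show "ennreal (m A) + ennreal (m B) \<le> ennreal (m (A \<union> B))" if "A \<inter> B = {}" for A B
      using add[OF that] m0 by (simp add: ennreal_plus)
    show "ennreal (m UNIV) < \<infinity>" by simp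
  qed
  then obtain \<mu> :: "'m measure" where sets [simp, measurable_cong]: "sets \<mu> = sets borel"
    and op: "\<And>U. open U \<Longrightarrow> emeasure \<mu> U = (SUP K\<in>{K. compact K \<and> K \<subseteq> U}. ennreal (m K))"
    and reg: "\<And>A. A \<in> sets borel \<Longrightarrow> emeasure \<mu> A = (INF U\<in>{U. open U \<and> A \<subseteq> U}. emeasure \<mu> U)"
    by blast
  have space [simp]: "space \<mu> = UNIV" using sets_eq_imp_space_eq[OF sets] by simp
  have \<mu>1: "emeasure \<mu> UNIV = 1"
  proof -
    have "(SUP K\<in>{K. compact K \<and> K \<subseteq> UNIV}. ennreal (m K)) = ennreal (m UNIV)"
      by (rule antisym) (use compact_M in \<open>auto intro!: SUP_least SUP_upper ennreal_leI mono\<close>)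
    then show ?thesis using op[of UNIV] m1 by simp
  qed
  interpret prob_space \<mu> by (rule prob_spaceI) (simp add: \<mu>1)

  \<comment> \<open>Quasi-invariance on open sets, then on Borel sets\<close>
  have le_open: "ennreal (m K) \<le> emeasure \<mu> U" if "compact K" "K \<subseteq> U" "open U" for K U
    unfolding op[OF that(3)] by (rule SUP_upper) (use that in auto)
  have open_vimage: "open (\<gamma> -` U)" if "\<gamma> \<in> \<Gamma>" "open U" for \<gamma> U
    using open_vimage[OF that(2) continuous_element[OF that(1)]] .
  have upper_open: "emeasure \<mu> (\<gamma> -` U) \<le> ennreal (exp (\<delta> * \<kappa> - \<delta> * c)) * emeasure \<mu> U"
    if \<gamma>: "\<gamma> \<in> \<Gamma>" and U: "open U" and c: "\<And>x. x \<in> U \<Longrightarrow> c \<le> \<sigma> (iv \<gamma>) x" for \<gamma> U c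
    unfolding op[OF open_vimage[OF \<gamma> U]]
  proof (rule SUP_least)
    fix L assume "L \<in> {K. compact K \<and> K \<subseteq> \<gamma> -` U}"
    then have L: "compact L" "L \<subseteq> \<gamma> -` U" by auto
    \<comment> \<open>The image of \<open>L\<close> is a compact subset of \<open>U\<close>, so the
      bound for the content can be compared with the supremum defining the measure of
      \<open>U\<close>.\<close>
    have K: "compact (\<gamma> ` L)" by (rule compact_continuous_image[OF continuous_element[OF \<gamma>] L(1)])
    have "L \<subseteq> \<gamma> -` (\<gamma> ` L)" by auto
    then have "m L \<le> m (\<gamma> -` (\<gamma> ` L))" by (rule mono)
    also have "\<dots> \<le> exp (\<delta> * \<kappa> - \<delta> * c) * m (\<gamma> ` L)"
      by (rule upper[OF \<gamma>]) (use L c in auto)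
    finally have "ennreal (m L) \<le> ennreal (exp (\<delta> * \<kappa> - \<delta> * c)) * ennreal (m (\<gamma> ` L))"
      using m0 by (simp add: ennreal_mult[symmetric] ennreal_leI)
    also have "\<dots> \<le> ennreal (exp (\<delta> * \<kappa> - \<delta> * c)) * emeasure \<mu> U"
      by (intro mult_left_mono le_open K U) (use L in auto)
    finally show "ennreal (m L) \<le> ennreal (exp (\<delta> * \<kappa> - \<delta> * c)) * emeasure \<mu> U" .
  qed
  have lower_open: "emeasure \<mu> U \<le> ennreal (exp (\<delta> * \<kappa> + \<delta> * c)) * emeasure \<mu> (\<gamma> -` U)"
    if \<gamma>: "\<gamma> \<in> \<Gamma>" and U: "open U" and c: "\<And>x. x \<in> U \<Longrightarrow> \<sigma> (iv \<gamma>) x \<le> c" for \<gamma> U c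
    unfolding op[OF U]
  proof (rule SUP_least)
    fix K assume "K \<in> {K. compact K \<and> K \<subseteq> U}"
    then have K: "compact K" "K \<subseteq> U" by auto
    have "\<gamma> -` K = iv \<gamma> ` K" using \<gamma> by (force simp: image_iff)
    then have L: "compact (\<gamma> -` K)"
      using compact_continuous_image[OF continuous_element[OF iv_mem[OF \<gamma>]] K(1)] by simp
    have "m K \<le> exp (\<delta> * \<kappa> + \<delta> * c) * m (\<gamma> -` K)"
      by (rule lower[OF \<gamma>]) (use K c in auto)
    then have "ennreal (m K) \<le> ennreal (exp (\<delta> * \<kappa> + \<delta> * c)) * ennreal (m (\<gamma> -` K))"
      using m0 by (simp add: ennreal_mult[symmetric] ennreal_leI)
    also have "\<dots> \<le> ennreal (exp (\<delta> * \<kappa> + \<delta> * c)) * emeasure \<mu> (\<gamma> -` U)"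
      by (intro mult_left_mono le_open L open_vimage[OF \<gamma> U]) (use K in auto)
    finally show "ennreal (m K) \<le> ennreal (exp (\<delta> * \<kappa> + \<delta> * c)) * emeasure \<mu> (\<gamma> -` U)" .
  qed
  have meas [measurable]: "\<gamma> \<in> borel_measurable \<mu>" if "\<gamma> \<in> \<Gamma>" for \<gamma> :: "'m \<Rightarrow> 'm"
    using borel_measurable_continuous_onI[OF continuous_element[OF that]]
    by (simp add: measurable_cong_sets[OF sets refl])
  have vimage_borel: "\<gamma> -` A \<in> sets borel" if "\<gamma> \<in> \<Gamma>" "A \<in> sets borel" for \<gamma> A
    using measurable_sets[OF meas[OF that(1)] that(2)] by simp
  have upper_borel: "emeasure \<mu> (\<gamma> -` A) \<le> ennreal (exp (\<delta> * \<kappa> - \<delta> * c)) * emeasure \<mu> A"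
    if \<gamma>: "\<gamma> \<in> \<Gamma>" and V: "open V" and c: "\<And>x. x \<in> V \<Longrightarrow> c \<le> \<sigma> (iv \<gamma>) x"
      and A: "A \<in> sets borel" "A \<subseteq> V" for \<gamma> V c A
  proof -
    let ?k = "ennreal (exp (\<delta> * \<kappa> - \<delta> * c))"
    \<comment> \<open>Moving the constant to the left leaves a bare infimum on the right.
      Approximating open sets are cut down to \<open>V\<close>, where the bound on the cocycle
      holds.\<close>
    have "emeasure \<mu> (\<gamma> -` A) / ?k \<le> emeasure \<mu> A"
      unfolding reg[OF A(1)]
    proof (rule INF_greatest)
      fix U assume "U \<in> {U. open U \<and> A \<subseteq> U}"
      then have U: "open U" "A \<subseteq> U" by auto
      have "emeasure \<mu> (\<gamma> -` A) \<le> emeasure \<mu> (\<gamma> -` (U \<inter> V))"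
        by (rule emeasure_mono) (use U V A vimage_borel[OF \<gamma>, of "U \<inter> V"] in auto)
      also have "\<dots> \<le> ?k * emeasure \<mu> (U \<inter> V)"
        by (rule upper_open[OF \<gamma>]) (use U V c in auto)
      also have "\<dots> \<le> ?k * emeasure \<mu> U"
        by (intro mult_left_mono emeasure_mono) (use U in auto)
      finally show "emeasure \<mu> (\<gamma> -` A) / ?k \<le> emeasure \<mu> U"
        by (intro divide_le_posI_ennreal) (auto simp: mult.commute)
    qed
    then show ?thesis by (rule ennreal_le_mult_of_divide_le) simp
  qed
  have lower_borel: "emeasure \<mu> A \<le> ennreal (exp (\<delta> * \<kappa> + \<delta> * c)) * emeasure \<mu> (\<gamma> -` A)"
    if \<gamma>: "\<gamma> \<in> \<Gamma>" and V: "open V" and c: "\<And>x. x \<in> V \<Longrightarrow> \<sigma> (iv \<gamma>) x \<le> c"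
      and A: "A \<in> sets borel" "A \<subseteq> V" for \<gamma> V c A
  proof -
    let ?k = "ennreal (exp (\<delta> * \<kappa> + \<delta> * c))"
    have "emeasure \<mu> A / ?k \<le> emeasure \<mu> (\<gamma> -` A)"
      unfolding reg[OF vimage_borel[OF \<gamma> A(1)]]
    proof (rule INF_greatest)
      fix U' assume "U' \<in> {U. open U \<and> \<gamma> -` A \<subseteq> U}"
      then have U': "open U'" "\<gamma> -` A \<subseteq> U'" by auto
      \<comment> \<open>Outer regularity is applied to the preimage of \<open>A\<close>, so its
        neighbourhood \<open>U'\<close> is transported forward to a neighbourhood of
        \<open>A\<close> and intersected with \<open>V\<close>.\<close>
      define U where "U = (iv \<gamma> -` U') \<inter> V"
      have U: "open U" unfolding U_def by (intro open_Int open_vimage iv_mem \<gamma> U' V)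
      have AU: "A \<subseteq> U"
      proof
        fix a assume a: "a \<in> A"
        then have "iv \<gamma> a \<in> \<gamma> -` A" using \<gamma> by simp
        then show "a \<in> U" using U'(2) A(2) a by (auto simp: U_def)
      qed
      have sub: "\<gamma> -` U \<subseteq> U'" using \<gamma> by (auto simp: U_def)
      have "emeasure \<mu> A \<le> emeasure \<mu> U" by (rule emeasure_mono) (use AU U in auto)
      also have "\<dots> \<le> ?k * emeasure \<mu> (\<gamma> -` U)"
        by (rule lower_open[OF \<gamma> U]) (use c in \<open>auto simp: U_def\<close>)
      also have "\<dots> \<le> ?k * emeasure \<mu> U'"
        by (intro mult_left_mono emeasure_mono) (use U' sub in auto)
      finally show "emeasure \<mu> A / ?k \<le> emeasure \<mu> U'"
        by (intro divide_le_posI_ennreal) (auto simp: mult.commute)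
    qed
    then show ?thesis by (rule ennreal_le_mult_of_divide_le) simp
  qed
  \<comment> \<open>The complement of the limit set is open, and every compact subset of it has
    content 0.\<close>
  have supp: "emeasure \<mu> (limit_set \<Gamma>) = 1"
  proof -
    have "emeasure \<mu> (- limit_set \<Gamma>) \<le> 0"
      unfolding op[OF open_Compl[OF closed_limit_set]]
    proof (rule SUP_least)
      fix K assume "K \<in> {K. compact K \<and> K \<subseteq> - limit_set \<Gamma>}"
      then have "compact K" "K \<inter> limit_set \<Gamma> = {}" by auto
      then show "ennreal (m K) \<le> 0" by (simp add: support)
    qed
    then have "prob (- limit_set \<Gamma>) = 0" by (simp add: measure_def)
    moreover have "limit_set \<Gamma> \<in> events" using closed_limit_set by simp
    ultimately have "prob (limit_set \<Gamma>) = 1"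
      using prob_compl[of "limit_set \<Gamma>"] by (simp add: Compl_eq_Diff_UNIV)
    then show ?thesis by (simp add: emeasure_eq_measure)
  qed

  \<comment> \<open>Bounds on the Radon-Nikodym derivative\<close>
  have "patterson_sullivan \<Gamma> \<sigma> (2 * \<kappa> * \<delta>) \<delta> \<mu>"
    unfolding patterson_sullivan_def
  proof (intro conjI ballI)
    show "prob_space \<mu>" by (rule prob_space_axioms)
    show "sets \<mu> = sets borel" by (rule sets)
    fix \<gamma> assume \<gamma>: "\<gamma> \<in> \<Gamma>"
    let ?\<nu> = "distr \<mu> borel \<gamma>"
    note [measurable] = meas[OF \<gamma>]
    have \<nu>: "emeasure ?\<nu> A = emeasure \<mu> (\<gamma> -` A)" if "A \<in> sets borel" for A
      using that by (simp add: emeasure_distr[OF meas[OF \<gamma>]])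
    \<comment> \<open>Open sets with one-sided cocycle bounds, as the Borel estimates require.
      Rational levels are countably many, so the exceptional null sets can be united.\<close>
    define V where "V c = interior {x. of_rat c \<le> \<sigma> (iv \<gamma>) x}" for c :: rat
    define V' where "V' c = interior {x. \<sigma> (iv \<gamma>) x \<le> of_rat c}" for c :: rat
    have V: "open (V c)" "\<And>x. x \<in> V c \<Longrightarrow> of_rat c \<le> \<sigma> (iv \<gamma>) x" for c
      using interior_subset unfolding V_def by auto
    have V': "open (V' c)" "\<And>x. x \<in> V' c \<Longrightarrow> \<sigma> (iv \<gamma>) x \<le> of_rat c" for c
      using interior_subset unfolding V'_def by auto
    \<comment> \<open>Coarse continuity reaches an open neighbourhood only at levels lower than the
      value at \<open>x\<close> by more than \<open>\<kappa>\<close>; this gap is the second loss of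
      \<open>\<kappa>\<close>.\<close>
    have V_mem: "x \<in> V c" if "of_rat c < \<sigma> (iv \<gamma>) x - \<kappa>" for x c
    proof -
      have "\<forall>\<^sub>F y in nhds x. \<bar>\<sigma> (iv \<gamma>) x - \<sigma> (iv \<gamma>) y\<bar> < \<kappa> + (\<sigma> (iv \<gamma>) x - \<kappa> - of_rat c)"
        by (rule cocycle_near) (use \<gamma> that in auto)
      then have "\<forall>\<^sub>F y in nhds x. of_rat c \<le> \<sigma> (iv \<gamma>) y" by eventually_elim linarith
      then show ?thesis unfolding V_def eventually_nhds interior_def by blast
    qed
    have V'_mem: "x \<in> V' c" if "\<sigma> (iv \<gamma>) x + \<kappa> < of_rat c" for x c
    proof -
      have "\<forall>\<^sub>F y in nhds x. \<bar>\<sigma> (iv \<gamma>) x - \<sigma> (iv \<gamma>) y\<bar> < \<kappa> + (of_rat c - (\<sigma> (iv \<gamma>) x + \<kappa>))"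
        by (rule cocycle_near) (use \<gamma> that in auto)
      then have "\<forall>\<^sub>F y in nhds x. \<sigma> (iv \<gamma>) y \<le> of_rat c" by eventually_elim linarith
      then show ?thesis unfolding V'_def eventually_nhds interior_def by blast
    qed
    have V_UN: "(\<Union>c. V c) = UNIV"
    proof -
      have "\<exists>c. x \<in> V c" for x
      proof -
        obtain c where "of_rat c < \<sigma> (iv \<gamma>) x - \<kappa>"
          using of_rat_dense[of "\<sigma> (iv \<gamma>) x - \<kappa> - 1" "\<sigma> (iv \<gamma>) x - \<kappa>"] by auto
        then show ?thesis using V_mem by blast
      qed
      then show ?thesis by blast
    qed
    have V'_UN: "(\<Union>c. V' c) = UNIV"
    proof -
      have "\<exists>c. x \<in> V' c" for x
      proof -
        obtain c where "\<sigma> (iv \<gamma>) x + \<kappa> < of_rat c"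
          using of_rat_dense[of "\<sigma> (iv \<gamma>) x + \<kappa>" "\<sigma> (iv \<gamma>) x + \<kappa> + 1"] by auto
        then show ?thesis using V'_mem by blast
      qed
      then show ?thesis by blast
    qed
    define k where "k c = ennreal (exp (\<delta> * \<kappa> - \<delta> * of_rat c))" for c :: rat
    define k' where "k' c = ennreal (exp (\<delta> * \<kappa> + \<delta> * of_rat c))" for c :: rat
    have up: "emeasure ?\<nu> A \<le> k c * emeasure \<mu> A" if "A \<in> sets borel" "A \<subseteq> V c" for A c
      unfolding \<nu>[OF that(1)] k_def by (rule upper_borel[OF \<gamma> V that])
    have low: "emeasure \<mu> A \<le> k' c * emeasure ?\<nu> A" if "A \<in> sets borel" "A \<subseteq> V' c" for A c
      unfolding \<nu>[OF that(1)] k'_def by (rule lower_borel[OF \<gamma> V' that])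
    show ac: "absolutely_continuous \<mu> ?\<nu>"
      by (rule null_set_of_open_cover_bound[OF sets _ V(1) V_UN up]) auto
    show "absolutely_continuous ?\<nu> \<mu>"
      by (rule null_set_of_open_cover_bound[OF _ sets V'(1) V'_UN low]) auto
    let ?f = "RN_deriv \<mu> ?\<nu>"
    have dens: "density \<mu> ?f = ?\<nu>"
      by (rule density_RN_deriv[OF ac]) simp
    have int: "(\<integral>\<^sup>+x. ?f x * indicator A x \<partial>\<mu>) = emeasure ?\<nu> A" if "A \<in> sets borel" for A
      using emeasure_density[of ?f \<mu> A] that dens by simp
    have emeasure_less_top: "emeasure \<mu> A < \<top>" for A
      using emeasure_finite[of A] by (metis top.not_eq_extremum infinity_ennreal_def)
    have \<nu>_fin: "emeasure ?\<nu> A < \<infinity>" if "A \<in> sets borel" for A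
      unfolding \<nu>[OF that] infinity_ennreal_def by (rule emeasure_less_top)
    have "AE x in \<mu>. x \<in> V c \<longrightarrow> ?f x \<le> k c" for c
    proof (rule AE_le_of_set_nn_integral_le)
      show "(\<integral>\<^sup>+x. ?f x * indicator A x \<partial>\<mu>) \<le> (\<integral>\<^sup>+x. k c * indicator A x \<partial>\<mu>)"
        if "A \<in> events" "A \<subseteq> V c" for A
        using up[OF _ that(2)] that(1) by (simp add: int nn_integral_cmult_indicator)
      show "(\<integral>\<^sup>+x. k c * indicator (V c) x \<partial>\<mu>) < \<infinity>"
        using V(1)[of c] emeasure_less_top[of "V c"]
        by (simp add: nn_integral_cmult_indicator k_def ennreal_mult_less_top)
    qed (use V(1)[of c] in auto)
    then have AE1: "AE x in \<mu>. \<forall>c. x \<in> V c \<longrightarrow> ?f x \<le> k c"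
      unfolding AE_all_countable by blast
    \<comment> \<open>The lower bound stays in multiplied form until the density is known to be a
      real number.\<close>
    have "AE x in \<mu>. x \<in> V' c \<longrightarrow> 1 \<le> k' c * ?f x" for c
    proof (rule AE_le_of_set_nn_integral_le)
      have eq: "(\<integral>\<^sup>+x. k' c * ?f x * indicator A x \<partial>\<mu>) = k' c * emeasure ?\<nu> A"
        if "A \<in> sets borel" for A
      proof -
        have "(\<lambda>x. ?f x * indicator A x) \<in> borel_measurable \<mu>"
          using that by (intro borel_measurable_times_ennreal borel_measurable_RN_deriv borel_measurable_indicator) simp
        from nn_integral_cmult[OF this, of "k' c"] show ?thesis by (simp add: mult.assoc int[OF that])
      qed
      show "(\<integral>\<^sup>+x. 1 * indicator A x \<partial>\<mu>) \<le> (\<integral>\<^sup>+x. k' c * ?f x * indicator A x \<partial>\<mu>)"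
        if "A \<in> events" "A \<subseteq> V' c" for A
        using low[OF _ that(2)] that(1) by (simp add: eq)
      show "(\<integral>\<^sup>+x. k' c * ?f x * indicator (V' c) x \<partial>\<mu>) < \<infinity>"
        unfolding eq[OF borel_open[OF V'(1)]] unfolding k'_def
        using \<nu>_fin[OF borel_open[OF V'(1)], of c] by (simp add: ennreal_mult_less_top)
    qed (use V'(1)[of c] in auto)
    then have AE2: "AE x in \<mu>. \<forall>c. x \<in> V' c \<longrightarrow> 1 \<le> k' c * ?f x"
      unfolding AE_all_countable by blast
    show "AE x in \<mu>. ennreal (exp (- (2 * \<kappa> * \<delta>) - \<delta> * \<sigma> (iv \<gamma>) x)) \<le> ?f x \<and>
      ?f x \<le> ennreal (exp (2 * \<kappa> * \<delta> - \<delta> * \<sigma> (iv \<gamma>) x))"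
      using AE1 AE2
    proof eventually_elim
      case (elim x)
      obtain q where q: "of_rat q < \<sigma> (iv \<gamma>) x - \<kappa>"
        using of_rat_dense[of "\<sigma> (iv \<gamma>) x - \<kappa> - 1" "\<sigma> (iv \<gamma>) x - \<kappa>"] by auto
      have "?f x \<le> k q" using elim(1) V_mem[OF q] by blast
      then have "?f x < \<infinity>" by (auto simp: k_def intro: le_less_trans)
      then obtain r where r: "?f x = ennreal r" "0 \<le> r" by (cases "?f x") auto
      \<comment> \<open>Rational levels accumulate at
        \<open>\<sigma> (iv \<gamma>) x - \<kappa>\<close> from the left; there the exponent
        \<open>\<delta> * \<kappa> - \<delta> * t\<close> becomes \<open>2 * \<kappa> * \<delta> -
        \<delta> * \<sigma> (iv \<gamma>) x\<close>.\<close>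
      have "r \<le> exp (2 * \<kappa> * \<delta> - \<delta> * \<sigma> (iv \<gamma>) x)"
      proof (rule tendsto_lowerbound)
        show "((\<lambda>t. exp (\<delta> * \<kappa> - \<delta> * t)) \<longlongrightarrow> exp (2 * \<kappa> * \<delta> - \<delta> * \<sigma> (iv \<gamma>) x)) (at_left (\<sigma> (iv \<gamma>) x - \<kappa>))"
          by (auto intro!: tendsto_eq_intros simp: algebra_simps)
        show "\<forall>\<^sub>F t in at_left (\<sigma> (iv \<gamma>) x - \<kappa>). r \<le> exp (\<delta> * \<kappa> - \<delta> * t)"
        proof (rule eventually_at_leftI[of "\<sigma> (iv \<gamma>) x - \<kappa> - 1"])
          fix t assume t: "t \<in> {\<sigma> (iv \<gamma>) x - \<kappa> - 1<..<\<sigma> (iv \<gamma>) x - \<kappa>}"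
          then obtain c where c: "t < of_rat c" "of_rat c < \<sigma> (iv \<gamma>) x - \<kappa>"
            using of_rat_dense[of t "\<sigma> (iv \<gamma>) x - \<kappa>"] by auto
          have "?f x \<le> k c" using elim(1) V_mem[OF c(2)] by blast
          then have "r \<le> exp (\<delta> * \<kappa> - \<delta> * of_rat c)" using r by (simp add: k_def)
          also have "\<dots> \<le> exp (\<delta> * \<kappa> - \<delta> * t)"
            using c(1) \<delta>_nonneg by (simp add: mult_left_mono)
          finally show "r \<le> exp (\<delta> * \<kappa> - \<delta> * t)" .
        qed simp
      qed simp
      \<comment> \<open>Symmetrically, levels descend to
        \<open>\<sigma> (iv \<gamma>) x + \<kappa>\<close> from the right.\<close>
      moreover have "exp (- (2 * \<kappa> * \<delta>) - \<delta> * \<sigma> (iv \<gamma>) x) \<le> r"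
      proof (rule tendsto_upperbound)
        show "((\<lambda>t. exp (- (\<delta> * \<kappa>) - \<delta> * t)) \<longlongrightarrow> exp (- (2 * \<kappa> * \<delta>) - \<delta> * \<sigma> (iv \<gamma>) x)) (at_right (\<sigma> (iv \<gamma>) x + \<kappa>))"
          by (auto intro!: tendsto_eq_intros simp: algebra_simps)
        show "\<forall>\<^sub>F t in at_right (\<sigma> (iv \<gamma>) x + \<kappa>). exp (- (\<delta> * \<kappa>) - \<delta> * t) \<le> r"
        proof (rule eventually_at_rightI[of _ "\<sigma> (iv \<gamma>) x + \<kappa> + 1"])
          fix t assume t: "t \<in> {\<sigma> (iv \<gamma>) x + \<kappa><..<\<sigma> (iv \<gamma>) x + \<kappa> + 1}"
          then obtain c where c: "\<sigma> (iv \<gamma>) x + \<kappa> < of_rat c" "of_rat c < t"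
            using of_rat_dense[of "\<sigma> (iv \<gamma>) x + \<kappa>" t] by auto
          have "1 \<le> k' c * ?f x" using elim(2) V'_mem[OF c(1)] by blast
          then have "1 \<le> exp (\<delta> * \<kappa> + \<delta> * of_rat c) * r"
            using r by (simp add: k'_def ennreal_mult[symmetric])
          also have "\<dots> \<le> exp (\<delta> * \<kappa> + \<delta> * t) * r"
            using c(2) \<delta>_nonneg r(2) by (intro mult_right_mono) (auto simp: mult_left_mono)
          finally have "exp (- (\<delta> * \<kappa> + \<delta> * t)) * 1
            \<le> exp (- (\<delta> * \<kappa> + \<delta> * t)) * (exp (\<delta> * \<kappa> + \<delta> * t) * r)"
            by (rule mult_left_mono) simp
          also have "\<dots> = r" by (simp add: mult.assoc[symmetric] exp_add[symmetric])
          finally show "exp (- (\<delta> * \<kappa>) - \<delta> * t) \<le> r" by simp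
        qed simp
      qed simp
      ultimately show ?case using r by (simp add: ennreal_leI)
    qed
  qed
  then show ?thesis using supp by blast
qed

end

theorem theorem4p1:
  fixes \<Gamma> :: "('m::metric_space \<Rightarrow> 'm) set"
    and d :: "('m \<Rightarrow> 'm) + 'm \<Rightarrow> ('m \<Rightarrow> 'm) + 'm \<Rightarrow> real"
    and \<sigma> :: "('m \<Rightarrow> 'm) \<Rightarrow> 'm \<Rightarrow> real"
    and mag :: "('m \<Rightarrow> 'm) \<Rightarrow> real"
    and \<kappa> \<delta> :: real
  assumes "compact (UNIV :: 'm set)"
    and "convergence_group \<Gamma>"
    and "non_elementary \<Gamma>"
    and "compatible_metric \<Gamma> d"
    and "coarse_cocycle \<kappa> \<Gamma> \<sigma>"
    and "expanding \<Gamma> d \<sigma>"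
    and "magnitude \<Gamma> d \<sigma> mag"
    and "critical_exponent \<Gamma> mag = ereal \<delta>"
  shows "\<exists>\<mu> :: 'm measure. patterson_sullivan \<Gamma> \<sigma> (2 * \<kappa> * \<delta>) \<delta> \<mu> \<and>
           emeasure \<mu> (limit_set \<Gamma>) = 1"
proof -
  interpret compactified_convergence_group \<Gamma> d
    by unfold_locales (rule assms)+
  \<comment> \<open>Base points and scale come from the geometry of the compactification alone,
    before the cocycle is brought in.\<close>
  obtain P \<epsilon> where P: "finite P" "0 < \<epsilon>" and far: "\<And>g h. g \<in> \<Gamma> \<Longrightarrow> h \<in> \<Gamma> \<Longrightarrow>
      \<exists>p\<in>P. d (Inr p) (Inl g) > 2 * \<epsilon> \<and> d (Inr p) (Inl h) > 2 * \<epsilon>"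
    using far_points by auto
  interpret coarse_cocycle_with_magnitude \<Gamma> d \<sigma> mag \<kappa> \<delta> P \<epsilon>
    by unfold_locales (use assms P far in auto)
  show ?thesis by (rule patterson_sullivan_measure_exists)
qed



end
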